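(* There is an absolute constant $C > 1$ such that the following holds. Let $n, k$ and $\ell$ be positive integers satisfying $n > 2k\ell^2$, and let $\alpha, \beta$ be real numbers with $\max\left(2\ell|\alpha|, |\beta|\right) \le \frac{n-2k}{(20C)^2 n}$. If $\mathcal{F} \subset \binom{[n]}{k}$ is a family of size $|\mathcal{F}| = (\ell - \alpha)\binom{n-1}{k-1}$ with $\mathrm{dp}(\mathcal{F}) \le \left(\binom{\ell}{2} + \beta\right)\binom{n-1}{k-1}\binom{n-k-1}{k-1}$, then there is a family $\mathcal{S}$ that is the union of $\ell$ stars satisfying \[ |\mathcal{F} \,\Delta\, \mathcal{S}| \le C\big((2\ell-1)\alpha + 2\beta\big)\frac{n}{n-2k}\binom{n-1}{k-1}. \]
   Context: $[n] = \{1,\dots,n\}$ and $\binom{[n]}{k}$ is the family of all $k$-element subsets of $[n]$. For a family $\mathcal{F}$ of sets, $\mathrm{dp}(\mathcal{F})$ denotes the number of unordered pairs $\{F, G\}$ of sets in $\mathcal{F}$ with $F \cap G = \emptyset$. The star with centre $i \in [n]$ is the family $\{F \in \binom{[n]}{k} : i \in F\}$; a union of $\ell$ stars means the union of the stars with $\ell$ distinct centres. $\Delta$ denotes symmetric difference. *)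

theory Defs
  imports Complex_Main "HOL-Library.Ramsey"
begin

definition dp :: "'a set set \<Rightarrow> nat" where
  "dp \<F> = card {{F, G} | F G. F \<in> \<F> \<and> G \<in> \<F> \<and> F \<noteq> G \<and> F \<inter> G = {}}"

definition star :: "nat \<Rightarrow> nat \<Rightarrow> nat \<Rightarrow> nat set set" where
  "star n k i = {F \<in> nsets {1..n} k. i \<in> F}"

definition union_of_stars :: "nat \<Rightarrow> nat \<Rightarrow> nat \<Rightarrow> nat set set \<Rightarrow> bool" where
  "union_of_stars n k l \<S> \<longleftrightarrow>
     (\<exists>I. I \<subseteq> {1..n} \<and> card I = l \<and> \<S> = (\<Union>i\<in>I. star n k i))"

end

theory Submission
  imports Defs "HOL-Analysis.Analysis"
begin

text \<open>Let \<open>f\<close> be the indicator function of \<open>\<F>\<close> and \<open>g(x) = \<Sum>\<^bsub>i\<in>x\<^esub> a\<^sub>i\<close> its orthogonal projection to the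
  linear functions on the slice. The Kneser graph acts on the functions orthogonal to the linear ones with
  eigenvalues at least \<open>- C(n-k-2, k-2)\<close>, so counting disjoint pairs as \<open>\<langle>f, A f\<rangle> / 2\<close> bounds
  \<open>\<parallel>f - g\<parallel>\<^sup>2\<close> by \<open>\<delta> C(n-1, k-1)\<close>, where \<open>\<delta> = ((2l-1)\<alpha> + 2\<beta>) n/(n-2k)\<close> is small.

  Restricted to a random cube \<open>\<Prod>\<^sub>t {u\<^sub>t, v\<^sub>t}\<close> inside the slice, \<open>2g - 1\<close> is a signed sum whose modulus is
  close to one, hence it is close to a single signed variable. Averaging over the cubes shows that, up to a
  common shift, the \<open>a\<^sub>i\<close> are close in \<open>\<ell>\<^sup>2\<close> to integers, so \<open>f\<close> is within \<open>O(\<delta>) C(n-1, k-1)\<close> of an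
  integral affine function \<open>w = c + \<Sum>\<^bsub>i\<in>x\<^esub> b\<^sub>i\<close>. Since \<open>w(w - 1) \<ge> 0\<close> nearly vanishes on average and the
  mean of \<open>w\<close> is nearly \<open>l k/n\<close>, the variance of \<open>w\<close> forces \<open>w(x) = \<bar>x \<inter> S\<bar>\<close> with \<open>\<bar>S\<bar> = l\<close>, unless
  \<open>l = 1\<close> and \<open>w\<close> is the indicator of the complement of a star; but a family close to that contains too many
  disjoint pairs.\<close>

section \<open>Signed sums with modulus close to one\<close>

text \<open>The slice is not a product space, and \<open>k/n\<close> may be tiny or close to 1/2, so
  rounding on a biased cube could cost a factor depending on \<open>k/n\<close>. A random cube tests
  \<open>k\<close> pairs of coefficients at once, and this \<open>k\<close> exactly compensates the
  density of the slice, so the loss is absolute. Mean-zero linear functions have eigenvalue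
  \<open>- C(n-k-1, k-1)\<close>; the relative gap to the bound on the remaining functions is
  \<open>(n-2k)/(n-k-1)\<close>, the source of the factor \<open>n/(n-2k)\<close>. Constants: 6 for
  splitting a signed sum into two parts; 20 = 6 + 14 for a dominant coordinate; 80 = 4 * 20 because
  \<open>2g - 1\<close> doubles distances; 648 = 4 (2 + 2 * 80) for passing from real to integral
  functions; 1000 is a round number above 648. The hypothesis makes 648 \<delta> at most 1944 /
  20000^2, far below the 1/200 that the discrete case analysis tolerates.\<close>

lemma square_sum_le: "(x + y)\<^sup>2 \<le> 2 * x\<^sup>2 + 2 * y\<^sup>2" for x y :: real
  using sum_squares_bound[of x y] by (simp add: power2_sum)

text \<open>A Rademacher sum: \<open>A\<close> is the set of plus signs, and expectations become
  sums over \<open>Pow I\<close> divided by \<open>2 ^ card I\<close>. Elements of \<open>A\<close>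
  outside \<open>I\<close> are ignored, so the same \<open>A\<close> serves for every block of
  coordinates.\<close>

definition rad :: "('a \<Rightarrow> real) \<Rightarrow> 'a set \<Rightarrow> 'a set \<Rightarrow> real" where
  "rad d I A = (\<Sum>t\<in>I. if t \<in> A then d t else - d t)"

lemma rad_cong: "A \<inter> I = B \<inter> I \<Longrightarrow> rad d I A = rad d I B"
  unfolding rad_def by (rule sum.cong) auto

lemma rad_insert:
  assumes "finite I" "x \<notin> I" "A \<subseteq> I"
  shows "rad d (insert x I) A = rad d I A - d x"
    and "rad d (insert x I) (insert x A) = rad d I A + d x"
proof -
  show "rad d (insert x I) A = rad d I A - d x"
    using assms by (auto simp: rad_def)
  have "rad d I (insert x A) = rad d I A"
    using assms by (intro rad_cong) auto
  then show "rad d (insert x I) (insert x A) = rad d I A + d x"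
    using assms by (simp add: rad_def)
qed

lemma rad_union:
  assumes "finite S" "finite T" "S \<inter> T = {}"
  shows "rad d (S \<union> T) A = rad d S A + rad d T A"
  using assms by (simp add: rad_def sum.union_disjoint)

lemma rad_complement: "A \<subseteq> I \<Longrightarrow> rad d I (I - A) = - rad d I A"
  unfolding rad_def sum_negf[symmetric] by (rule sum.cong) auto

lemma sum_Pow_insert:
  fixes \<phi> :: "'a set \<Rightarrow> real"
  assumes "finite I" "x \<notin> I"
  shows "(\<Sum>A\<in>Pow (insert x I). \<phi> A) = (\<Sum>A\<in>Pow I. \<phi> A + \<phi> (insert x A))"
proof -
  have inj: "inj_on (insert x) (Pow I)"
    using assms(2) by (intro inj_onI) (metis Diff_insert_absorb PowD insert_Diff_if insert_absorb subset_iff insert_ident)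
  have "(\<Sum>A\<in>Pow (insert x I). \<phi> A) = (\<Sum>A\<in>Pow I. \<phi> A) + (\<Sum>A\<in>insert x ` Pow I. \<phi> A)"
    unfolding Pow_insert using assms by (intro sum.union_disjoint) auto
  also have "(\<Sum>A\<in>insert x ` Pow I. \<phi> A) = (\<Sum>A\<in>Pow I. \<phi> (insert x A))"
    by (simp add: sum.reindex[OF inj])
  finally show ?thesis by (simp add: sum.distrib)
qed

text \<open>Independence of the signs on two disjoint blocks.\<close>

lemma sum_Pow_union:
  fixes \<phi> \<psi> :: "'a set \<Rightarrow> real"
  assumes "S \<inter> T = {}"
  shows "(\<Sum>A\<in>Pow (S \<union> T). \<phi> (A \<inter> S) * \<psi> (A \<inter> T)) = (\<Sum>A\<in>Pow S. \<phi> A) * (\<Sum>A\<in>Pow T. \<psi> A)"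
proof -
  have "(\<Sum>A\<in>Pow S. \<phi> A) * (\<Sum>A\<in>Pow T. \<psi> A) = (\<Sum>(A,B)\<in>Pow S \<times> Pow T. \<phi> A * \<psi> B)"
    by (simp add: sum_product sum.cartesian_product)
  also have "\<dots> = (\<Sum>A\<in>Pow (S \<union> T). \<phi> (A \<inter> S) * \<psi> (A \<inter> T))"
  proof (rule sum.reindex_bij_witness[of _ "\<lambda>A. (A \<inter> S, A \<inter> T)" "\<lambda>(A,B). A \<union> B"], goal_cases)
    case (1 a) then show ?case using assms by auto
  next
    case (2 a) then show ?case by auto
  next
    case (3 b) then show ?case by auto
  next
    case (4 b) then show ?case by auto
  next
    case (5 a)
    then obtain A B where "a = (A, B)" "A \<subseteq> S" "B \<subseteq> T" by auto
    moreover from this have "(A \<union> B) \<inter> S = A" "(A \<union> B) \<inter> T = B" using assms by auto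
    ultimately show ?case by simp
  qed
  finally show ?thesis ..
qed

lemma rad_second_moment:
  assumes "finite I"
  shows "(\<Sum>A\<in>Pow I. (rad d I A)\<^sup>2) = 2 ^ card I * (\<Sum>t\<in>I. (d t)\<^sup>2)"
  using assms
proof (induction I)
  case empty
  then show ?case by (simp add: rad_def)
next
  case (insert x I)
  have "(\<Sum>A\<in>Pow (insert x I). (rad d (insert x I) A)\<^sup>2) =
      (\<Sum>A\<in>Pow I. 2 * (rad d I A)\<^sup>2 + 2 * (d x)\<^sup>2)"
    unfolding sum_Pow_insert[OF insert.hyps(1,2)]
    by (intro sum.cong) (simp_all add: rad_insert[OF insert.hyps(1,2)] power2_eq_square algebra_simps)
  also have "\<dots> = 2 ^ card (insert x I) * (\<Sum>t\<in>insert x I. (d t)\<^sup>2)"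
    using insert by (simp add: sum.distrib sum_distrib_left[symmetric] card_Pow algebra_simps)
  finally show ?case .
qed

text \<open>The Khinchine bound with the Gaussian constant 3; it takes the place of
  hypercontractivity for functions of degree one.\<close>

lemma rad_fourth_moment:
  assumes "finite I"
  shows "(\<Sum>A\<in>Pow I. (rad d I A) ^ 4) \<le> 2 ^ card I * (3 * (\<Sum>t\<in>I. (d t)\<^sup>2)\<^sup>2)"
  using assms
proof (induction I)
  case empty
  then show ?case by (simp add: rad_def)
next
  case (insert x I)
  define s where "s = (\<Sum>t\<in>I. (d t)\<^sup>2)"
  have pw: "(r - e) ^ 4 + (r + e) ^ 4 = 2 * r ^ 4 + 12 * e\<^sup>2 * r\<^sup>2 + 2 * (e\<^sup>2)\<^sup>2" for r e :: real
    by (simp add: power4_eq_xxxx power2_eq_square algebra_simps)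
  have "(\<Sum>A\<in>Pow (insert x I). (rad d (insert x I) A) ^ 4) =
      (\<Sum>A\<in>Pow I. 2 * (rad d I A) ^ 4 + 12 * (d x)\<^sup>2 * (rad d I A)\<^sup>2 + 2 * ((d x)\<^sup>2)\<^sup>2)"
    unfolding sum_Pow_insert[OF insert.hyps(1,2)]
    by (intro sum.cong refl) (simp only: rad_insert[OF insert.hyps(1,2)] Pow_iff pw)
  also have "\<dots> = 2 * (\<Sum>A\<in>Pow I. (rad d I A) ^ 4) + 12 * (d x)\<^sup>2 * (2 ^ card I * s)
       + 2 ^ card I * (2 * ((d x)\<^sup>2)\<^sup>2)"
    using insert.hyps by (simp add: sum.distrib sum_distrib_left[symmetric] card_Pow rad_second_moment s_def)
  \<comment> \<open>The exact coefficient 2 of the fourth power is raised to 6 so that the terms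
    complete the square \<open>6 * ((d x)\<^sup>2 + s)\<^sup>2\<close>.\<close>
  also have "\<dots> \<le> 2 * (2 ^ card I * (3 * s\<^sup>2)) + 12 * (d x)\<^sup>2 * (2 ^ card I * s)
       + 2 ^ card I * (6 * ((d x)\<^sup>2)\<^sup>2)"
    using insert.IH unfolding s_def by (intro add_mono mult_left_mono) auto
  also have "\<dots> = 2 ^ card (insert x I) * (3 * (\<Sum>t\<in>insert x I. (d t)\<^sup>2)\<^sup>2)"
  proof -
    have "(\<Sum>t\<in>insert x I. (d t)\<^sup>2) = (d x)\<^sup>2 + s" using insert.hyps by (simp add: s_def)
    then show ?thesis using insert.hyps by (simp only: card_insert_disjoint power_Suc) (simp add: power2_sum algebra_simps)
  qed
  finally show ?case .
qed

text \<open>A polynomial minorant of \<open>min\<close>, so that second and fourth moments of the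
  signed sums suffice: for independent \<open>u\<close>, \<open>v\<close> of mean 1 and second
  moment at most 3 its mean is at least (12 - 3 - 3) / 36 = 1/6. The 36 is the maximum of
  \<open>y * (12 - y)\<close>.\<close>

lemma min_ge_polynomial:
  fixes u v :: real
  assumes "u \<ge> 0" "v \<ge> 0"
  shows "min u v \<ge> u * v * (12 - u - v) / 36"
proof -
  have key: "x \<ge> x * y * (12 - x - y) / 36" if "0 \<le> x" "0 \<le> y" for x y :: real
  proof -
    have "y * (12 - x - y) \<le> y * (12 - y)" using that by (simp add: mult_left_mono)
    also have "\<dots> = 36 - (y - 6)\<^sup>2" by (simp add: power2_eq_square algebra_simps)
    also have "\<dots> \<le> 36" by simp
    finally have "x * (y * (12 - x - y)) \<le> x * 36" using that by (intro mult_left_mono)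
    then show ?thesis by (simp add: mult.assoc)
  qed
  show ?thesis using key[OF assms] key[OF assms(2,1)] by (simp add: min_def algebra_simps)
qed

text \<open>Dividing both squares by their means makes the polynomial minorant have mean at least
  1/6; the smaller variance \<open>a\<close> can be pulled out of the minimum because
  \<open>a \<le> b\<close>.\<close>

lemma rad_sum_min_ge_aux:
  assumes fin: "finite S" "finite T" and disj: "S \<inter> T = {}"
    and le: "(\<Sum>t\<in>S. (d t)\<^sup>2) \<le> (\<Sum>t\<in>T. (d t)\<^sup>2)"
  shows "2 ^ card (S \<union> T) * ((\<Sum>t\<in>S. (d t)\<^sup>2) / 6)
    \<le> (\<Sum>A\<in>Pow (S \<union> T). min ((rad d S A)\<^sup>2) ((rad d T A)\<^sup>2))"
proof -
  define a where "a = (\<Sum>t\<in>S. (d t)\<^sup>2)"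
  define b where "b = (\<Sum>t\<in>T. (d t)\<^sup>2)"
  have ab: "0 \<le> a" "a \<le> b" using le by (auto simp: a_def b_def sum_nonneg)
  have fST: "finite (S \<union> T)" using fin by simp
  show ?thesis
  proof (cases "a = 0")
    case True
    then show ?thesis unfolding a_def by (simp add: sum_nonneg)
  next
    case False
    then have a: "a > 0" and b: "b > 0" using ab by auto
    define u where "u A = (rad d S A)\<^sup>2 / a" for A
    define v where "v A = (rad d T A)\<^sup>2 / b" for A
    have "rad d S (A \<inter> S) = rad d S A" "rad d T (A \<inter> T) = rad d T A" for A
      by (rule rad_cong; auto)+
    then have uS: "u (A \<inter> S) = u A" and vT: "v (A \<inter> T) = v A" for A
      unfolding u_def v_def by simp_all
    have prod: "(\<Sum>A\<in>Pow (S \<union> T). (u A) ^ i * (v A) ^ j) =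
       (\<Sum>A\<in>Pow S. (u A)^i) * (\<Sum>A\<in>Pow T. (v A)^j)" for i j :: nat
      using sum_Pow_union[OF disj, of "\<lambda>A. (u A)^i" "\<lambda>A. (v A)^j"] by (simp only: uS vT)
    have u1: "(\<Sum>A\<in>Pow S. (u A)^1) = 2 ^ card S"
      using a by (simp add: u_def sum_divide_distrib[symmetric] rad_second_moment[OF fin(1)] a_def[symmetric])
    have v1: "(\<Sum>A\<in>Pow T. (v A)^1) = 2 ^ card T"
      using b by (simp add: v_def sum_divide_distrib[symmetric] rad_second_moment[OF fin(2)] b_def[symmetric])
    have u2: "(\<Sum>A\<in>Pow S. (u A)^2) \<le> 2 ^ card S * 3"
      using a rad_fourth_moment[OF fin(1), of d]
      by (simp add: u_def power_divide sum_divide_distrib[symmetric] a_def[symmetric] field_simps)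
    have v2: "(\<Sum>A\<in>Pow T. (v A)^2) \<le> 2 ^ card T * 3"
      using b rad_fourth_moment[OF fin(2), of d]
      by (simp add: v_def power_divide sum_divide_distrib[symmetric] b_def[symmetric] field_simps)
    have card: "(2::real) ^ card (S \<union> T) = 2 ^ card S * 2 ^ card T"
      using fin disj by (simp add: card_Un_disjoint power_add)
    have "2 ^ card (S \<union> T) * (a / 6) = a * (12 * (2 ^ card S * 2 ^ card T) - (2 ^ card S * 3) * 2 ^ card T
         - 2 ^ card S * (2 ^ card T * 3)) / 36"
      by (simp add: card field_simps)
    also have "\<dots> \<le> a * (12 * (\<Sum>A\<in>Pow (S \<union> T). (u A)^1 * (v A)^1) - (\<Sum>A\<in>Pow (S \<union> T). (u A)^2 * (v A)^1)
         - (\<Sum>A\<in>Pow (S \<union> T). (u A)^1 * (v A)^2)) / 36"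
      unfolding prod u1 v1 using a u2 v2
      by (intro divide_right_mono mult_left_mono diff_mono mult_right_mono) auto
    also have "\<dots> = (\<Sum>A\<in>Pow (S \<union> T). a * (u A * v A * (12 - u A - v A) / 36))"
      by (simp add: sum_distrib_left sum_divide_distrib sum_subtractf[symmetric] power2_eq_square algebra_simps)
    also have "\<dots> \<le> (\<Sum>A\<in>Pow (S \<union> T). min ((rad d S A)\<^sup>2) ((rad d T A)\<^sup>2))"
    proof (rule sum_mono)
      fix A
      have nn: "u A \<ge> 0" "v A \<ge> 0" using a b by (auto simp: u_def v_def)
      have "a * (u A * v A * (12 - u A - v A) / 36) \<le> a * min (u A) (v A)"
        using a min_ge_polynomial[OF nn] by (intro mult_left_mono) auto
      also have "\<dots> \<le> min (a * u A) (b * v A)"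
        using a b ab nn by (auto simp: min_def intro: mult_mono mult_left_mono)
      also have "\<dots> = min ((rad d S A)\<^sup>2) ((rad d T A)\<^sup>2)"
        using a b by (simp add: u_def v_def)
      finally show "a * (u A * v A * (12 - u A - v A) / 36) \<le> min ((rad d S A)\<^sup>2) ((rad d T A)\<^sup>2)" .
    qed
    finally show ?thesis unfolding a_def .
  qed
qed

lemma rad_sum_min_ge:
  assumes fin: "finite S" "finite T" and disj: "S \<inter> T = {}"
  shows "2 ^ card (S \<union> T) * (min (\<Sum>t\<in>S. (d t)\<^sup>2) (\<Sum>t\<in>T. (d t)\<^sup>2) / 6)
    \<le> (\<Sum>A\<in>Pow (S \<union> T). min ((rad d S A)\<^sup>2) ((rad d T A)\<^sup>2))"
proof (cases "(\<Sum>t\<in>S. (d t)\<^sup>2) \<le> (\<Sum>t\<in>T. (d t)\<^sup>2)")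
  case True
  then show ?thesis using rad_sum_min_ge_aux[OF assms True] by (simp add: min_def)
next
  case False
  then have le: "(\<Sum>t\<in>T. (d t)\<^sup>2) \<le> (\<Sum>t\<in>S. (d t)\<^sup>2)" by simp
  have "T \<inter> S = {}" using disj by auto
  from rad_sum_min_ge_aux[OF fin(2,1) this le] show ?thesis
    using False by (simp add: min.commute Un_commute min_def)
qed

text \<open>Since \<open>X + Y\<close> and \<open>X - Y\<close> are equidistributed, the fluctuation of \<open>\<bar>X + Y\<bar>\<close> controls
  \<open>\<bar>\<bar>X + Y\<bar> - \<bar>X - Y\<bar>\<bar> = 2 min \<bar>X\<bar> \<bar>Y\<bar>\<close>, so one of the two parts has small variance.\<close>

lemma rad_split_variance:
  assumes fin: "finite S" "finite T" and disj: "S \<inter> T = {}"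
    and dev: "(\<Sum>A\<in>Pow (S \<union> T). (\<bar>rad d (S \<union> T) A\<bar> - 1)\<^sup>2) \<le> 2 ^ card (S \<union> T) * \<eta>"
  shows "min (\<Sum>t\<in>S. (d t)\<^sup>2) (\<Sum>t\<in>T. (d t)\<^sup>2) \<le> 6 * \<eta>"
proof -
  define \<phi> where "\<phi> A = (\<bar>rad d (S \<union> T) A\<bar> - 1)\<^sup>2" for A
  \<comment> \<open>\<open>fl\<close> reverses the signs on \<open>T\<close>: an involution of the
    cube that turns \<open>X + Y\<close> into \<open>X - Y\<close>.\<close>
  define fl where "fl A = (A \<inter> S) \<union> (T - A)" for A
  have flip: "(\<Sum>A\<in>Pow (S \<union> T). \<phi> (fl A)) = (\<Sum>A\<in>Pow (S \<union> T). \<phi> A)"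
    by (rule sum.reindex_bij_witness[of _ fl fl]) (use disj in \<open>auto simp: fl_def\<close>)
  have pw: "min (x\<^sup>2) (y\<^sup>2) \<le> ((\<bar>x + y\<bar> - 1)\<^sup>2 + (\<bar>x - y\<bar> - 1)\<^sup>2) / 2" for x y :: real
  proof -
    have "4 * min (x\<^sup>2) (y\<^sup>2) \<le> (\<bar>x + y\<bar> - \<bar>x - y\<bar>)\<^sup>2"
    proof (cases "\<bar>x\<bar> \<le> \<bar>y\<bar>")
      case True
      then have "\<bar>\<bar>x + y\<bar> - \<bar>x - y\<bar>\<bar> = \<bar>2 * x\<bar>" by (auto simp: abs_if split: if_splits)
      then have "(\<bar>x + y\<bar> - \<bar>x - y\<bar>)\<^sup>2 = (2 * x)\<^sup>2" by (metis power2_abs)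
      then show ?thesis by (simp add: min_def)
    next
      case False
      then have "\<bar>\<bar>x + y\<bar> - \<bar>x - y\<bar>\<bar> = \<bar>2 * y\<bar>" by (auto simp: abs_if split: if_splits)
      then have "(\<bar>x + y\<bar> - \<bar>x - y\<bar>)\<^sup>2 = (2 * y)\<^sup>2" by (metis power2_abs)
      then show ?thesis by (simp add: min_def)
    qed
    also have "\<dots> \<le> 2 * (\<bar>x + y\<bar> - 1)\<^sup>2 + 2 * (\<bar>x - y\<bar> - 1)\<^sup>2"
      using zero_le_power2[of "(\<bar>x + y\<bar> - 1) + (\<bar>x - y\<bar> - 1)"]
      by (simp only: power2_eq_square) (simp add: algebra_simps)
    finally show ?thesis by simp
  qed
  have "2 ^ card (S \<union> T) * (min (\<Sum>t\<in>S. (d t)\<^sup>2) (\<Sum>t\<in>T. (d t)\<^sup>2) / 6)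
    \<le> (\<Sum>A\<in>Pow (S \<union> T). min ((rad d S A)\<^sup>2) ((rad d T A)\<^sup>2))"
    by (rule rad_sum_min_ge[OF fin disj])
  also have "\<dots> \<le> (\<Sum>A\<in>Pow (S \<union> T). (\<phi> A + \<phi> (fl A)) / 2)"
  proof (rule sum_mono)
    fix A assume "A \<in> Pow (S \<union> T)"
    have 1: "rad d S (fl A) = rad d S A"
      using disj by (intro rad_cong) (auto simp: fl_def)
    have "rad d T (fl A) = rad d T (T - (A \<inter> T))"
      using disj by (intro rad_cong) (auto simp: fl_def)
    also have "\<dots> = - rad d T (A \<inter> T)" by (rule rad_complement) auto
    also have "rad d T (A \<inter> T) = rad d T A" by (rule rad_cong) auto
    finally have 2: "rad d T (fl A) = - rad d T A" .
    show "min ((rad d S A)\<^sup>2) ((rad d T A)\<^sup>2) \<le> (\<phi> A + \<phi> (fl A)) / 2"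
      using pw[of "rad d S A" "rad d T A"] by (simp add: \<phi>_def rad_union[OF fin disj] 1 2)
  qed
  also have "\<dots> = (\<Sum>A\<in>Pow (S \<union> T). \<phi> A)"
    by (simp add: sum_divide_distrib[symmetric] sum.distrib flip)
  also have "\<dots> \<le> 2 ^ card (S \<union> T) * \<eta>" using dev by (simp add: \<phi>_def)
  finally show ?thesis by simp
qed

text \<open>The squared distance from \<open>x\<close> to the set {-1, 0, 1}.\<close>

definition int_defect :: "real \<Rightarrow> real" where
  "int_defect x = min (x\<^sup>2) ((\<bar>x\<bar> - 1)\<^sup>2)"

lemma int_defect_nonneg: "int_defect x \<ge> 0"
  by (simp add: int_defect_def)

lemma int_defect_minus: "int_defect (- x) = int_defect x"
  by (simp add: int_defect_def)

text \<open>A form of the Friedgut--Kalai--Naor theorem.\<close>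

lemma rad_near_dictator:
  assumes fin: "finite I"
    and dev: "(\<Sum>A\<in>Pow I. (\<bar>rad d I A\<bar> - 1)\<^sup>2) \<le> 2 ^ card I * \<eta>"
  shows "(\<Sum>t\<in>I. int_defect (d t)) \<le> 20 * \<eta>"
proof -
  have "0 \<le> (\<Sum>A\<in>Pow I. (\<bar>rad d I A\<bar> - 1)\<^sup>2)" by (simp add: sum_nonneg)
  with dev have "0 \<le> 2 ^ card I * \<eta>" by linarith
  then have eta: "\<eta> \<ge> 0" by (metis zero_le_mult_iff zero_less_numeral zero_less_power not_less)
  have split: "min (\<Sum>t\<in>S. (d t)\<^sup>2) (\<Sum>t\<in>I-S. (d t)\<^sup>2) \<le> 6 * \<eta>" if "S \<subseteq> I" for S
  proof -
    have eq: "S \<union> (I - S) = I" using that by auto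
    have "finite S" using that fin finite_subset by blast
    then show ?thesis
      using rad_split_variance[of S "I - S" d \<eta>, unfolded eq] fin dev by auto
  qed
  show ?thesis
  \<comment> \<open>Either one coordinate carries all but 6 \<eta> of the variance, or
    \<open>split\<close> makes every single coordinate small.\<close>
  proof (cases "\<exists>m\<in>I. (\<Sum>t\<in>I-{m}. (d t)\<^sup>2) \<le> 6 * \<eta>")
    case True
    then obtain m where m: "m \<in> I" and small: "(\<Sum>t\<in>I-{m}. (d t)\<^sup>2) \<le> 6 * \<eta>" by auto
    have "(\<Sum>A\<in>Pow I. (rad d (I - {m}) A)\<^sup>2) = 2 * (\<Sum>A\<in>Pow (I - {m}). (rad d (I - {m}) A)\<^sup>2)"
    proof -
      have I: "I = insert m (I - {m})" using m by auto
      have "rad d (I - {m}) (insert m A) = rad d (I - {m}) A" for A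
        by (rule rad_cong) auto
      then show ?thesis
        using sum_Pow_insert[of "I - {m}" m "\<lambda>A. (rad d (I - {m}) A)\<^sup>2"] fin I
        by (simp add: sum_distrib_left)
    qed
    also have "\<dots> = 2 * 2 ^ card (I - {m}) * (\<Sum>t\<in>I-{m}. (d t)\<^sup>2)"
      using fin by (simp add: rad_second_moment)
    also have "2 * 2 ^ card (I - {m}) = (2::real) ^ card I"
      using m fin by (metis card_Suc_Diff1 power_Suc)
    finally have Y: "(\<Sum>A\<in>Pow I. (rad d (I - {m}) A)\<^sup>2) \<le> 2 ^ card I * (6 * \<eta>)"
      using small by simp
    have "2 ^ card I * (\<bar>d m\<bar> - 1)\<^sup>2 = (\<Sum>A\<in>Pow I. (\<bar>d m\<bar> - 1)\<^sup>2)"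
      using fin by (simp add: card_Pow)
    also have "\<dots> \<le> (\<Sum>A\<in>Pow I. 2 * (\<bar>rad d I A\<bar> - 1)\<^sup>2 + 2 * (rad d (I - {m}) A)\<^sup>2)"
    proof (rule sum_mono)
      fix A
      have "rad d I A = rad d ({m} \<union> (I - {m})) A" using m by (simp add: insert_absorb)
      also have "\<dots> = rad d {m} A + rad d (I - {m}) A" using fin by (intro rad_union) auto
      finally have eq: "rad d I A = rad d {m} A + rad d (I - {m}) A" .
      have dm: "\<bar>rad d {m} A\<bar> = \<bar>d m\<bar>" by (simp add: rad_def)
      have "\<bar>\<bar>d m\<bar> - 1\<bar> \<le> \<bar>\<bar>rad d I A\<bar> - 1\<bar> + \<bar>rad d (I - {m}) A\<bar>"
        using eq dm by linarith
      then have "\<bar>\<bar>d m\<bar> - 1\<bar>\<^sup>2 \<le> (\<bar>\<bar>rad d I A\<bar> - 1\<bar> + \<bar>rad d (I - {m}) A\<bar>)\<^sup>2"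
        by (rule power_mono) simp
      also have "\<dots> \<le> 2 * \<bar>\<bar>rad d I A\<bar> - 1\<bar>\<^sup>2 + 2 * \<bar>rad d (I - {m}) A\<bar>\<^sup>2"
        by (rule square_sum_le)
      finally show "(\<bar>d m\<bar> - 1)\<^sup>2 \<le> 2 * (\<bar>rad d I A\<bar> - 1)\<^sup>2 + 2 * (rad d (I - {m}) A)\<^sup>2"
        by simp
    qed
    \<comment> \<open>14 = 2 * 1 + 2 * 6, from the deviation of the modulus and from the variance of
      the other coordinates. Adding the 6 for these coordinates themselves gives 20.\<close>
    also have "\<dots> \<le> 2 ^ card I * (14 * \<eta>)"
      using dev Y by (simp add: sum.distrib sum_distrib_left[symmetric])
    finally have "(\<bar>d m\<bar> - 1)\<^sup>2 \<le> 14 * \<eta>" by simp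
    moreover have "(\<Sum>t\<in>I. int_defect (d t)) = int_defect (d m) + (\<Sum>t\<in>I-{m}. int_defect (d t))"
      using fin m by (rule sum.remove)
    moreover have "(\<Sum>t\<in>I-{m}. int_defect (d t)) \<le> (\<Sum>t\<in>I-{m}. (d t)\<^sup>2)"
      by (intro sum_mono) (simp add: int_defect_def)
    ultimately show ?thesis using small by (simp add: int_defect_def)
  next
    case False
    then have each: "(d m)\<^sup>2 \<le> 6 * \<eta>" if "m \<in> I" for m
      using split[of "{m}"] that by (auto simp: min_def split: if_splits)
    \<comment> \<open>All coordinates contribute at most 6 \<eta>, so a larger total could be cut
      into two parts that both exceed 6 \<eta>, against \<open>split\<close>: take a largest set of
      variance at most 6 \<eta> and add one more coordinate.\<close>
    have "(\<Sum>t\<in>I. (d t)\<^sup>2) \<le> 18 * \<eta>"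
    proof (rule ccontr)
      assume big: "\<not> ?thesis"
      define Q where "Q S \<longleftrightarrow> S \<subseteq> I \<and> (\<Sum>t\<in>S. (d t)\<^sup>2) \<le> 6 * \<eta>" for S
      have "Q {}" using eta by (simp add: Q_def)
      moreover have "\<forall>S. Q S \<longrightarrow> card S < Suc (card I)" using fin by (auto simp: Q_def card_mono less_Suc_eq_le)
      ultimately obtain S where S: "Q S" and max: "\<And>S'. Q S' \<Longrightarrow> card S' \<le> card S"
        using ex_has_greatest_nat[of Q "{}" card "Suc (card I)"] by auto
      have finS: "finite S" using S fin finite_subset by (auto simp: Q_def)
      have "S \<noteq> I" using S big eta by (auto simp: Q_def)
      then obtain t where t: "t \<in> I" "t \<notin> S" using S by (auto simp: Q_def)
      have "\<not> Q (insert t S)" using max[of "insert t S"] t finS by auto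
      then have gt: "(\<Sum>t\<in>insert t S. (d t)\<^sup>2) > 6 * \<eta>" using S t by (auto simp: Q_def)
      have le: "(\<Sum>t\<in>insert t S. (d t)\<^sup>2) \<le> 12 * \<eta>"
        using S t finS each[of t] by (simp add: Q_def)
      have sub: "insert t S \<subseteq> I" using S t by (auto simp: Q_def)
      have "(\<Sum>t\<in>I - insert t S. (d t)\<^sup>2) = (\<Sum>t\<in>I. (d t)\<^sup>2) - (\<Sum>t\<in>insert t S. (d t)\<^sup>2)"
        using sub fin by (simp add: sum_diff)
      then have "(\<Sum>t\<in>I - insert t S. (d t)\<^sup>2) > 6 * \<eta>" using big le by linarith
      with gt split[OF sub] show False by (auto simp: min_def split: if_splits)
    qed
    moreover have "(\<Sum>t\<in>I. int_defect (d t)) \<le> (\<Sum>t\<in>I. (d t)\<^sup>2)"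
      by (intro sum_mono) (simp add: int_defect_def)
    ultimately show ?thesis using eta by linarith
  qed
qed

section \<open>Eigenvalues of the Kneser graph\<close>

text \<open>A minimiser of the quadratic form on the unit sphere of the invariant subspace
  \<open>U\<close> exists by compactness, and it is an eigenvector. \<open>U\<close> is given by
  linear equations, from which closedness and stability under linear combinations are
  immediate.\<close>

lemma rayleigh_eigenvector:
  fixes B :: "'b \<Rightarrow> 'b \<Rightarrow> real" and c :: "'i \<Rightarrow> 'b \<Rightarrow> real"
  assumes fin: "finite S"
    and sym: "\<And>x y. x \<in> S \<Longrightarrow> y \<in> S \<Longrightarrow> B x y = B y x"
    and U: "\<And>\<phi>. U \<phi> \<longleftrightarrow> (\<forall>i\<in>J. (\<Sum>x\<in>S. c i x * \<phi> x) = 0)"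
    and inv: "\<And>\<phi>. U \<phi> \<Longrightarrow> U (\<lambda>x. \<Sum>y\<in>S. B x y * \<phi> y)"
    and nontriv: "U \<phi>\<^sub>0" "x\<^sub>0 \<in> S" "\<phi>\<^sub>0 x\<^sub>0 \<noteq> 0"
  obtains \<theta> \<phi> where "U \<phi>" "\<exists>x\<in>S. \<phi> x \<noteq> 0" "\<And>x. x \<in> S \<Longrightarrow> (\<Sum>y\<in>S. B x y * \<phi> y) = \<theta> * \<phi> x"
    "\<And>\<psi>. U \<psi> \<Longrightarrow> (\<Sum>x\<in>S. \<Sum>y\<in>S. B x y * \<psi> x * \<psi> y) \<ge> \<theta> * (\<Sum>x\<in>S. (\<psi> x)\<^sup>2)"
proof -
  define Q where "Q \<psi> = (\<Sum>x\<in>S. \<Sum>y\<in>S. B x y * \<psi> x * \<psi> y)" for \<psi> :: "'b \<Rightarrow> real"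
  define nrm where "nrm \<psi> = (\<Sum>x\<in>S. (\<psi> x)\<^sup>2)" for \<psi> :: "'b \<Rightarrow> real"
  define T where "T \<phi> x = (\<Sum>y\<in>S. B x y * \<phi> y)" for \<phi> :: "'b \<Rightarrow> real" and x
  \<comment> \<open>Functions live on the whole type; forcing the value 0 off \<open>S\<close> makes
    the box compact by Tychonoff and does not affect \<open>Q\<close>, \<open>nrm\<close> or
    \<open>U\<close>.\<close>
  define box where "box = PiE UNIV (\<lambda>x. if x \<in> S then {-1..1::real} else {0})"
  have "compactin (product_topology (\<lambda>x::'b. euclidean::real topology) UNIV) box"
    unfolding box_def compactin_PiE by auto
  then have cbox: "compact box" by (simp add: euclidean_product_topology)
  have co: "continuous_on UNIV (\<lambda>\<psi>::'b \<Rightarrow> real. \<psi> x)" for x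
    by (rule continuous_on_product_coordinates)
  have cQ: "continuous_on UNIV Q" unfolding Q_def
    by (intro continuous_intros co)
  have cn: "continuous_on UNIV nrm" unfolding nrm_def
    by (intro continuous_intros co)
  have clU: "closed {\<psi>. U \<psi>}"
  proof -
    have "{\<psi>. U \<psi>} = (\<Inter>i\<in>J. {\<psi>. (\<Sum>x\<in>S. c i x * \<psi> x) = 0})" by (auto simp: U)
    also have "closed \<dots>"
      by (intro closed_INT ballI closed_Collect_eq continuous_intros co)
    finally show ?thesis .
  qed
  have cln: "closed {\<psi>. nrm \<psi> = 1}"
    by (intro closed_Collect_eq cn continuous_intros)
  define K where "K = box \<inter> ({\<psi>. U \<psi>} \<inter> {\<psi>. nrm \<psi> = 1})"
  have cK: "compact K" unfolding K_def using cbox clU cln by (intro compact_Int_closed closed_Int)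
  have scale: "Q (\<lambda>x. t * \<psi> x) = t\<^sup>2 * Q \<psi>" "nrm (\<lambda>x. t * \<psi> x) = t\<^sup>2 * nrm \<psi>" for t \<psi>
    by (simp_all add: Q_def nrm_def sum_distrib_left power2_eq_square mult_ac)
  have Uadd: "U (\<lambda>x. \<psi> x + t * \<xi> x)" if "U \<psi>" "U \<xi>" for \<psi> \<xi> t
  proof -
    have "(\<Sum>x\<in>S. c i x * (\<psi> x + t * \<xi> x)) = (\<Sum>x\<in>S. c i x * \<psi> x) + t * (\<Sum>x\<in>S. c i x * \<xi> x)" for i
      by (simp add: sum.distrib sum_distrib_left algebra_simps)
    then show ?thesis using that by (simp add: U)
  qed
  have U0: "U (\<lambda>x. 0)" by (simp add: U)
  have normalise: "\<exists>\<xi>\<in>K. \<exists>t. t\<^sup>2 * nrm \<psi> = 1 \<and> Q \<xi> = t\<^sup>2 * Q \<psi>" if "U \<psi>" "nrm \<psi> \<noteq> 0" for \<psi>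
  proof -
    have pos: "nrm \<psi> > 0" using that(2) unfolding nrm_def by (metis less_eq_real_def sum_nonneg zero_le_power2)
    define t where "t = 1 / sqrt (nrm \<psi>)"
    have t: "t\<^sup>2 * nrm \<psi> = 1" using pos by (simp add: t_def power_divide)
    define \<xi> where "\<xi> x = (if x \<in> S then t * \<psi> x else 0)" for x
    have "nrm \<xi> = nrm (\<lambda>x. t * \<psi> x)" by (simp add: nrm_def \<xi>_def)
    then have n1: "nrm \<xi> = 1" using t by (simp add: scale)
    have Q: "Q \<xi> = t\<^sup>2 * Q \<psi>" unfolding scale(1)[symmetric] by (simp add: Q_def \<xi>_def)
    have "U \<xi> \<longleftrightarrow> U (\<lambda>x. 0 + t * \<psi> x)" unfolding U by (simp add: \<xi>_def)
    then have "U \<xi>" using Uadd[OF U0 that(1)] by simp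
    moreover have "\<xi> \<in> box"
    proof -
      have "\<xi> x \<in> {-1..1}" if "x \<in> S" for x
      proof -
        have "(\<xi> x)\<^sup>2 \<le> nrm \<xi>" unfolding nrm_def using that fin by (intro member_le_sum) auto
        then show ?thesis using n1 by (simp add: abs_square_le_1 abs_le_iff)
      qed
      then show ?thesis by (auto simp: box_def \<xi>_def)
    qed
    ultimately have "\<xi> \<in> K" using n1 by (simp add: K_def)
    then show ?thesis using t Q by blast
  qed
  have "nrm \<phi>\<^sub>0 \<noteq> 0" using nontriv(2,3) fin by (auto simp: nrm_def sum_nonneg_eq_0_iff)
  then have "K \<noteq> {}" using normalise[OF nontriv(1)] by auto
  then obtain \<phi> where \<phi>: "\<phi> \<in> K" and min: "\<And>\<psi>. \<psi> \<in> K \<Longrightarrow> Q \<phi> \<le> Q \<psi>"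
    using continuous_attains_inf[OF cK] continuous_on_subset[OF cQ] by (metis subset_UNIV)
  define \<theta> where "\<theta> = Q \<phi>"
  have U\<phi>: "U \<phi>" and n\<phi>: "nrm \<phi> = 1" using \<phi> by (auto simp: K_def)
  have ge: "Q \<psi> \<ge> \<theta> * nrm \<psi>" if "U \<psi>" for \<psi>
  proof (cases "nrm \<psi> = 0")
    case True
    then have "\<psi> x = 0" if "x \<in> S" for x
      using that fin by (auto simp: nrm_def sum_nonneg_eq_0_iff)
    then show ?thesis using True by (simp add: Q_def)
  next
    case False
    then obtain \<xi> t where *: "\<xi> \<in> K" "t\<^sup>2 * nrm \<psi> = 1" "Q \<xi> = t\<^sup>2 * Q \<psi>"
      using normalise[OF \<open>U \<psi>\<close>] by auto
    have "\<theta> * (t\<^sup>2 * nrm \<psi>) \<le> t\<^sup>2 * Q \<psi>" using min[OF *(1)] *(2,3) by (simp add: \<theta>_def)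
    then have "t\<^sup>2 * (\<theta> * nrm \<psi>) \<le> t\<^sup>2 * Q \<psi>" by (simp add: mult_ac)
    moreover have "t\<^sup>2 > 0" using *(2) by (cases "t = 0") auto
    ultimately show ?thesis by simp
  qed
  \<comment> \<open>Half the gradient of \<open>Q - \<theta> * nrm\<close> at the minimiser; by
    invariance it lies in \<open>U\<close>, so it is an admissible direction.\<close>
  define \<psi> where "\<psi> x = T \<phi> x + (- \<theta>) * \<phi> x" for x
  have U\<psi>: "U \<psi>" unfolding \<psi>_def
    by (rule Uadd[OF _ U\<phi>]) (use inv[OF U\<phi>] in \<open>simp add: T_def\<close>)
  have expand: "Q (\<lambda>x. \<phi> x + t * \<psi> x) - \<theta> * nrm (\<lambda>x. \<phi> x + t * \<psi> x) =
      2 * t * nrm \<psi> + t\<^sup>2 * (Q \<psi> - \<theta> * nrm \<psi>)" for t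
  proof -
    have swap: "(\<Sum>x\<in>S. \<Sum>y\<in>S. B x y * \<phi> x * \<psi> y) = (\<Sum>x\<in>S. \<psi> x * T \<phi> x)"
    proof -
      have "(\<Sum>x\<in>S. \<Sum>y\<in>S. B x y * \<phi> x * \<psi> y) = (\<Sum>y\<in>S. \<Sum>x\<in>S. B x y * \<phi> x * \<psi> y)"
        by (rule sum.swap)
      also have "\<dots> = (\<Sum>y\<in>S. \<psi> y * T \<phi> y)"
        unfolding T_def sum_distrib_left by (intro sum.cong refl) (simp add: sym mult_ac)
      finally show ?thesis .
    qed
    have swap': "(\<Sum>x\<in>S. \<Sum>y\<in>S. B x y * \<psi> x * \<phi> y) = (\<Sum>x\<in>S. \<psi> x * T \<phi> x)"
      unfolding T_def sum_distrib_left by (intro sum.cong refl) (simp add: mult_ac)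
    have "Q (\<lambda>x. \<phi> x + t * \<psi> x) = Q \<phi> + t * (\<Sum>x\<in>S. \<Sum>y\<in>S. B x y * \<phi> x * \<psi> y)
        + t * (\<Sum>x\<in>S. \<Sum>y\<in>S. B x y * \<psi> x * \<phi> y) + t\<^sup>2 * Q \<psi>"
      by (simp add: Q_def sum.distrib sum_distrib_left power2_eq_square algebra_simps)
    then have 1: "Q (\<lambda>x. \<phi> x + t * \<psi> x) = \<theta> + 2 * t * (\<Sum>x\<in>S. \<psi> x * T \<phi> x) + t\<^sup>2 * Q \<psi>"
      by (simp add: swap swap' \<theta>_def)
    have 2: "nrm (\<lambda>x. \<phi> x + t * \<psi> x) = 1 + 2 * t * (\<Sum>x\<in>S. \<psi> x * \<phi> x) + t\<^sup>2 * nrm \<psi>"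
      unfolding n\<phi>[symmetric]
      by (simp add: nrm_def sum.distrib sum_distrib_left power2_eq_square algebra_simps)
    have 3: "nrm \<psi> = (\<Sum>x\<in>S. \<psi> x * T \<phi> x) - \<theta> * (\<Sum>x\<in>S. \<psi> x * \<phi> x)"
      unfolding nrm_def sum_distrib_left sum_subtractf[symmetric]
      by (intro sum.cong refl) (simp add: \<psi>_def power2_eq_square algebra_simps)
    show ?thesis unfolding 1 2 3 by (simp add: algebra_simps)
  qed
  have "nrm \<psi> = 0"
  proof (rule ccontr)
    assume ne: "nrm \<psi> \<noteq> 0"
    have pos: "nrm \<psi> > 0" using ne unfolding nrm_def by (metis less_eq_real_def sum_nonneg zero_le_power2)
    define r where "r = Q \<psi> - \<theta> * nrm \<psi>"
    have r: "r \<ge> 0" using ge[OF U\<psi>] by (simp add: r_def)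
    \<comment> \<open>With this step length the linear term beats the quadratic one: at
      \<open>t = - s\<close> the expansion equals \<open>- s\<^sup>2 * (r + 2)\<close>, which
      \<open>ge\<close> forbids.\<close>
    define s where "s = nrm \<psi> / (r + 1)"
    have s: "s > 0" "nrm \<psi> = s * (r + 1)" using pos r by (simp_all add: s_def)
    have "2 * (- s) * nrm \<psi> + (- s)\<^sup>2 * r \<ge> 0"
      using ge[OF Uadd[OF U\<phi> U\<psi>, of "- s"]] expand[of "- s"] by (simp add: r_def)
    moreover have "2 * (- s) * nrm \<psi> + (- s)\<^sup>2 * r = - (s\<^sup>2 * (r + 2))"
      unfolding s(2) by (simp add: power2_eq_square algebra_simps)
    moreover have "s\<^sup>2 * (r + 2) > 0" using s(1) r by simp
    ultimately show False by linarith
  qed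
  then have "T \<phi> x = \<theta> * \<phi> x" if "x \<in> S" for x
    using that fin by (auto simp: nrm_def sum_nonneg_eq_0_iff \<psi>_def)
  moreover have "\<exists>x\<in>S. \<phi> x \<noteq> 0"
  proof (rule ccontr)
    assume "\<not> ?thesis"
    then have "nrm \<phi> = 0" by (simp add: nrm_def)
    then show False using n\<phi> by simp
  qed
  ultimately show thesis using that[of \<phi> \<theta>] U\<phi> ge unfolding T_def Q_def nrm_def by blast
qed

section \<open>The Kneser operator and its eigenvectors\<close>

definition kneser :: "'a set \<Rightarrow> nat \<Rightarrow> ('a set \<Rightarrow> real) \<Rightarrow> 'a set \<Rightarrow> real" where
  "kneser X k \<phi> x = (\<Sum>y | y \<in> nsets X k \<and> y \<inter> x = {}. \<phi> y)"

lemma card_nsets_finite: "finite X \<Longrightarrow> card (nsets X k) = card X choose k"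
proof -
  assume fin: "finite X"
  then have "nsets X k = {B. B \<subseteq> X \<and> card B = k}"
    by (auto simp: nsets_def intro: finite_subset)
  then show ?thesis using n_subsets[OF fin] by simp
qed

lemma sum_nsets_containing:
  fixes \<phi> :: "'a set \<Rightarrow> real"
  assumes "finite X" "i \<in> X"
  shows "(\<Sum>x | x \<in> nsets X (Suc m) \<and> i \<in> x \<and> P x. \<phi> x) =
    (\<Sum>z | z \<in> nsets (X - {i}) m \<and> P (insert i z). \<phi> (insert i z))"
proof (rule sum.reindex_bij_witness[of _ "insert i" "\<lambda>x. x - {i}"], goal_cases)
  case (1 a)
  then show ?case by auto
next
  case (2 a)
  then show ?case using assms by (auto simp: nsets_def insert_absorb)
next
  case (3 b)
  then show ?case by (auto simp: nsets_def)
next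
  case (4 b)
  then show ?case using assms by (auto simp: nsets_def card_insert_if)
next
  case (5 a)
  then show ?case by (simp add: insert_absorb)
qed

lemma card_nsets_containing:
  assumes "finite X" "i \<in> X"
  shows "card {x \<in> nsets X (Suc m). i \<in> x} = (card X - 1) choose m"
proof -
  have "real (card {x \<in> nsets X (Suc m). i \<in> x}) = (\<Sum>x | x \<in> nsets X (Suc m) \<and> i \<in> x \<and> True. 1)"
    by simp
  also have "\<dots> = real (card (nsets (X - {i}) m))"
    by (subst sum_nsets_containing[OF assms]) simp
  finally show ?thesis using assms by (simp add: card_nsets_finite)
qed

text \<open>Exchanging one element at a time leads from any set to any other. It is applied in
  contraposition: a nonconstant function changes under some exchange of \<open>a\<close> for
  \<open>b\<close>.\<close>

lemma swap_invariant_constant: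
  fixes \<phi> :: "'a set \<Rightarrow> real"
  assumes fin: "finite X"
    and swap: "\<And>a b z. a \<in> X \<Longrightarrow> b \<in> X \<Longrightarrow> a \<noteq> b \<Longrightarrow> z \<in> nsets (X - {a, b}) m \<Longrightarrow> \<phi> (insert a z) = \<phi> (insert b z)"
    and "x \<in> nsets X (Suc m)" "y \<in> nsets X (Suc m)"
  shows "\<phi> x = \<phi> y"
  using assms(3)
proof (induction "card (x - y)" arbitrary: x)
  case 0
  have fx: "finite x" "finite y" "card x = card y"
    using 0 assms(4) by (auto simp: nsets_def)
  then have "x \<subseteq> y" using 0 by simp
  then have "x = y" using fx card_subset_eq by blast
  then show ?case by simp
next
  case (Suc r)
  have fx: "finite x" "finite y" "card x = card y" "x \<subseteq> X" "y \<subseteq> X" "card x = Suc m"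
    using Suc.prems assms(4) by (auto simp: nsets_def)
  obtain a where a: "a \<in> x" "a \<notin> y" using Suc.hyps(2) by (metis DiffE card.empty ex_in_conv nat.distinct(1))
  have "card (y - x) = card (x - y)" using fx by (simp add: card_Diff_subset_Int Int_commute)
  then have "card (y - x) \<noteq> 0" using Suc.hyps(2) by simp
  then have "y - x \<noteq> {}" by (metis card.empty)
  then obtain b where b: "b \<in> y" "b \<notin> x" by auto
  define z where "z = x - {a}"
  have z: "z \<in> nsets (X - {a, b}) m" using fx a b by (auto simp: z_def nsets_def)
  have xz: "x = insert a z" using a by (auto simp: z_def)
  have "insert b z \<in> nsets X (Suc m)" using z fx b by (auto simp: nsets_def card_insert_if)
  moreover have "card (insert b z - y) = r"
  proof -
    have "insert b z - y = (x - y) - {a}" using b by (auto simp: z_def)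
    then show ?thesis using Suc.hyps(2) a fx by simp
  qed
  ultimately have "\<phi> (insert b z) = \<phi> y" using Suc.hyps(1) by metis
  moreover have "\<phi> (insert a z) = \<phi> (insert b z)"
    using swap[of a b z] a b fx z by auto
  ultimately show ?case using xz by simp
qed

text \<open>Sets avoiding both \<open>a\<close> and \<open>b\<close> occur in both sums and cancel.
  What remains at \<open>insert a z\<close> are the sets \<open>insert b w\<close>, and vice versa,
  hence the change of sign; \<open>w\<close> runs over the neighbours of \<open>z\<close> in a
  smaller Kneser graph.\<close>

lemma kneser_swap_difference:
  fixes \<phi> :: "'a set \<Rightarrow> real"
  assumes fin: "finite X" and ab: "a \<in> X" "b \<in> X" "a \<noteq> b"
    and eig: "\<And>x. x \<in> nsets X (Suc m) \<Longrightarrow> kneser X (Suc m) \<phi> x = \<theta> * \<phi> x"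
    and z: "z \<in> nsets (X - {a, b}) m"
  shows "kneser (X - {a, b}) m (\<lambda>z. \<phi> (insert a z) - \<phi> (insert b z)) z =
    - \<theta> * (\<phi> (insert a z) - \<phi> (insert b z))"
proof -
  have finN: "finite (nsets X (Suc m))" using fin by (rule finite_imp_finite_nsets)
  have zab: "a \<notin> z" "b \<notin> z" using z by (auto simp: nsets_def)
  have mem: "insert c z \<in> nsets X (Suc m)" if "c \<in> {a, b}" for c
    using z ab that zab by (auto simp: nsets_def)
  have half: "kneser X (Suc m) \<phi> (insert c z) =
     (\<Sum>y | y \<in> nsets X (Suc m) \<and> y \<inter> insert a (insert b z) = {}. \<phi> y) +
     (\<Sum>w | w \<in> nsets (X - {a, b}) m \<and> w \<inter> z = {}. \<phi> (insert d w))"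
    if cd: "c \<in> {a, b}" "{c, d} = {a, b}" "c \<noteq> d" for c d
  proof -
    have dX: "d \<in> X" using cd ab by auto
    have "kneser X (Suc m) \<phi> (insert c z) =
      (\<Sum>y | y \<in> nsets X (Suc m) \<and> y \<inter> insert c z = {} \<and> d \<notin> y. \<phi> y) +
      (\<Sum>y | y \<in> nsets X (Suc m) \<and> d \<in> y \<and> y \<inter> insert c z = {}. \<phi> y)"
      unfolding kneser_def
      by (subst sum.union_disjoint[symmetric]) (use finN in \<open>auto intro!: sum.cong\<close>)
    also have "(\<Sum>y | y \<in> nsets X (Suc m) \<and> d \<in> y \<and> y \<inter> insert c z = {}. \<phi> y) =
      (\<Sum>w | w \<in> nsets (X - {d}) m \<and> insert d w \<inter> insert c z = {}. \<phi> (insert d w))"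
      by (rule sum_nsets_containing[OF fin dX])
    also have "{w. w \<in> nsets (X - {d}) m \<and> insert d w \<inter> insert c z = {}} =
      {w. w \<in> nsets (X - {a, b}) m \<and> w \<inter> z = {}}"
      using cd zab by (auto simp: nsets_def)
    also have "{y. y \<in> nsets X (Suc m) \<and> y \<inter> insert c z = {} \<and> d \<notin> y} =
      {y. y \<in> nsets X (Suc m) \<and> y \<inter> insert a (insert b z) = {}}"
      using cd by auto
    finally show ?thesis .
  qed
  have "\<theta> * (\<phi> (insert a z) - \<phi> (insert b z)) =
      kneser X (Suc m) \<phi> (insert a z) - kneser X (Suc m) \<phi> (insert b z)"
    using eig mem by (simp add: algebra_simps)
  also have "\<dots> = - kneser (X - {a, b}) m (\<lambda>z. \<phi> (insert a z) - \<phi> (insert b z)) z"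
    using ab half[of a b] half[of b a] by (simp add: kneser_def sum_subtractf insert_commute)
  finally show ?thesis by simp
qed

text \<open>Evaluate the eigenvalue equation at a point of largest modulus; every vertex has the
  same number \<open>(card X - m) choose m\<close> of neighbours.\<close>

lemma kneser_eigenvalue_bound:
  assumes fin: "finite X" and eig: "\<And>x. x \<in> nsets X m \<Longrightarrow> kneser X m \<phi> x = \<theta> * \<phi> x"
    and nz: "x\<^sub>0 \<in> nsets X m" "\<phi> x\<^sub>0 \<noteq> 0"
  shows "\<bar>\<theta>\<bar> \<le> real ((card X - m) choose m)"
proof -
  have finN: "finite (nsets X m)" using fin by (rule finite_imp_finite_nsets)
  have im: "finite ((\<lambda>x. \<bar>\<phi> x\<bar>) ` nsets X m)" "(\<lambda>x. \<bar>\<phi> x\<bar>) ` nsets X m \<noteq> {}" using finN nz by auto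
  obtain x where x: "x \<in> nsets X m" "Max ((\<lambda>x. \<bar>\<phi> x\<bar>) ` nsets X m) = \<bar>\<phi> x\<bar>"
    using Max_in[OF im] by auto
  have max: "\<bar>\<phi> y\<bar> \<le> \<bar>\<phi> x\<bar>" if "y \<in> nsets X m" for y
    using Max_ge[OF im(1), of "\<bar>\<phi> y\<bar>"] that x(2) by simp
  have pos: "\<bar>\<phi> x\<bar> > 0" using max[OF nz(1)] nz(2) by simp
  have set: "{y. y \<in> nsets X m \<and> y \<inter> x = {}} = nsets (X - x) m" by (auto simp: nsets_def)
  have "\<bar>\<theta>\<bar> * \<bar>\<phi> x\<bar> = \<bar>kneser X m \<phi> x\<bar>" using eig[OF x(1)] by (simp add: abs_mult)
  also have "\<dots> \<le> (\<Sum>y | y \<in> nsets X m \<and> y \<inter> x = {}. \<bar>\<phi> y\<bar>)"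
    unfolding kneser_def by (rule sum_abs)
  also have "\<dots> \<le> (\<Sum>y | y \<in> nsets X m \<and> y \<inter> x = {}. \<bar>\<phi> x\<bar>)"
    by (rule sum_mono) (use max in auto)
  also have "\<dots> = real ((card X - m) choose m) * \<bar>\<phi> x\<bar>"
  proof -
    have "card (X - x) = card X - m" using x(1) fin by (simp add: nsets_def card_Diff_subset)
    then show ?thesis using fin unfolding set by (simp add: card_nsets_finite)
  qed
  finally show ?thesis using pos by simp
qed

lemma sum_nsets_by_element:
  fixes \<phi> :: "'a set \<Rightarrow> real"
  assumes fin: "finite X"
  shows "(\<Sum>i\<in>X. \<Sum>x | x \<in> nsets X k \<and> i \<in> x. \<phi> x * a i) = (\<Sum>x\<in>nsets X k. \<phi> x * (\<Sum>i\<in>x. a i))"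
proof -
  have finN: "finite (nsets X k)" using fin by (rule finite_imp_finite_nsets)
  have "(\<Sum>i\<in>X. \<Sum>x | x \<in> nsets X k \<and> i \<in> x. \<phi> x * a i) = (\<Sum>x\<in>nsets X k. \<Sum>i | i \<in> X \<and> i \<in> x. \<phi> x * a i)"
    by (rule sum.swap_restrict[OF fin finN])
  also have "\<dots> = (\<Sum>x\<in>nsets X k. \<phi> x * (\<Sum>i\<in>x. a i))"
  proof (rule sum.cong[OF refl])
    fix x assume "x \<in> nsets X k"
    then have "{i. i \<in> X \<and> i \<in> x} = x" by (auto simp: nsets_def)
    then show "(\<Sum>i | i \<in> X \<and> i \<in> x. \<phi> x * a i) = \<phi> x * (\<Sum>i\<in>x. a i)"
      by (simp add: sum_distrib_left)
  qed
  finally show ?thesis .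
qed

text \<open>Antisymmetrising a balanced eigenvector over two suitable disjoint transpositions leaves a
  nonzero eigenvector of the Kneser graph of \<open>(k-2)\<close>-subsets of the remaining \<open>n-4\<close> points.\<close>

lemma kneser_eigenvalue_bound_balanced:
  fixes \<phi> :: "'a set \<Rightarrow> real"
  assumes fin: "finite X" and k: "k > 0"
    and eig: "\<And>x. x \<in> nsets X k \<Longrightarrow> kneser X k \<phi> x = \<theta> * \<phi> x"
    and bal: "\<And>i. i \<in> X \<Longrightarrow> (\<Sum>x | x \<in> nsets X k \<and> i \<in> x. \<phi> x) = 0"
    and nz: "x\<^sub>0 \<in> nsets X k" "\<phi> x\<^sub>0 \<noteq> 0"
  shows "k \<ge> 2 \<and> \<bar>\<theta>\<bar> \<le> real ((card X - k - 2) choose (k - 2))"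
proof -
  obtain m where m: "k = Suc m" using k gr0_implies_Suc by blast
  have zero: "\<phi> x = 0" if "\<forall>x\<in>nsets Y j. \<phi> x = c" "x \<in> nsets Y j" "finite Y"
      "(\<Sum>x\<in>nsets Y j. \<phi> x) = 0" for \<phi> :: "'a set \<Rightarrow> real" and c x Y j
  proof -
    have "finite (nsets Y j)" using that by (simp add: finite_imp_finite_nsets)
    then have "card (nsets Y j) > 0" using that(2) card_gt_0_iff by blast
    moreover have "real (card (nsets Y j)) * c = 0" using that by simp
    ultimately show ?thesis using that by simp
  qed
  have "(\<Sum>x\<in>nsets X k. \<phi> x * (\<Sum>i\<in>x. 1)) = 0"
    unfolding sum_nsets_by_element[OF fin, symmetric] using bal by simp
  moreover have "(\<Sum>x\<in>nsets X k. \<phi> x * (\<Sum>i\<in>x. 1)) = real k * (\<Sum>x\<in>nsets X k. \<phi> x)"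
    unfolding sum_distrib_left by (intro sum.cong refl) (simp add: nsets_def)
  ultimately have sum0: "(\<Sum>x\<in>nsets X k. \<phi> x) = 0" using k by simp
  define \<psi> where "\<psi> a b z = \<phi> (insert a z) - \<phi> (insert b z)" for a b z
  \<comment> \<open>\<open>\<phi>\<close> is nonzero with sum zero, hence not constant, so some
    exchange changes it.\<close>
  have "\<exists>a b z. a \<in> X \<and> b \<in> X \<and> a \<noteq> b \<and> z \<in> nsets (X - {a, b}) m \<and> \<psi> a b z \<noteq> 0"
  proof (rule ccontr)
    assume no: "\<not> ?thesis"
    have "\<phi> (insert a z) = \<phi> (insert b z)"
      if "a \<in> X" "b \<in> X" "a \<noteq> b" "z \<in> nsets (X - {a, b}) m" for a b z
    proof -
      have "\<psi> a b z = 0" using no that by blast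
      then show ?thesis by (simp add: \<psi>_def)
    qed
    then have "\<forall>x\<in>nsets X k. \<phi> x = \<phi> x\<^sub>0"
      using swap_invariant_constant[OF fin, of m \<phi> _ x\<^sub>0] nz(1) unfolding m by blast
    then show False using zero[OF _ nz(1) fin sum0] nz(2) by blast
  qed
  then obtain a b z where ab: "a \<in> X" "b \<in> X" "a \<noteq> b" and z: "z \<in> nsets (X - {a, b}) m" "\<psi> a b z \<noteq> 0"
    by auto
  define Y where "Y = X - {a, b}"
  have finY: "finite Y" and cardY: "card Y = card X - 2"
    using fin ab by (auto simp: Y_def card_Diff_subset)
  have eig1: "kneser Y m (\<psi> a b) z = - \<theta> * \<psi> a b z" if "z \<in> nsets Y m" for z
    unfolding Y_def \<psi>_def
    by (rule kneser_swap_difference[OF fin ab]) (use eig m that Y_def in auto)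
  have sum1: "(\<Sum>z\<in>nsets Y m. \<psi> a b z) = 0"
  proof -
    \<comment> \<open>By balance at \<open>c\<close>, the sets with \<open>c\<close> but not
      \<open>d\<close> sum to minus those containing both. This value is the same for
      \<open>a\<close> and \<open>b\<close>, so \<open>\<psi> a b\<close> sums to zero and a second
      exchange can be found.\<close>
    have half: "(\<Sum>z\<in>nsets Y m. \<phi> (insert c z)) = - (\<Sum>x | x \<in> nsets X k \<and> a \<in> x \<and> b \<in> x. \<phi> x)"
      if cd: "c \<in> X" "{c, d} = {a, b}" "c \<noteq> d" for c d
    proof -
      have "0 = (\<Sum>x | x \<in> nsets X k \<and> c \<in> x. \<phi> x)" using bal cd by simp
      also have "\<dots> = (\<Sum>x | x \<in> nsets X k \<and> c \<in> x \<and> d \<in> x. \<phi> x) + (\<Sum>x | x \<in> nsets X k \<and> c \<in> x \<and> d \<notin> x. \<phi> x)"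
        by (subst sum.union_disjoint[symmetric]) (use fin in \<open>auto intro!: sum.cong simp: finite_imp_finite_nsets\<close>)
      also have "(\<Sum>x | x \<in> nsets X k \<and> c \<in> x \<and> d \<notin> x. \<phi> x) =
         (\<Sum>z | z \<in> nsets (X - {c}) m \<and> d \<notin> insert c z. \<phi> (insert c z))"
        unfolding m by (rule sum_nsets_containing[OF fin cd(1)])
      also have "{z. z \<in> nsets (X - {c}) m \<and> d \<notin> insert c z} = nsets Y m"
        using cd by (auto simp: nsets_def Y_def)
      also have "{x. x \<in> nsets X k \<and> c \<in> x \<and> d \<in> x} = {x. x \<in> nsets X k \<and> a \<in> x \<and> b \<in> x}"
        using cd by auto
      finally show ?thesis by simp
    qed
    show ?thesis using half[of a b] half[of b a] ab
      by (simp add: \<psi>_def sum_subtractf insert_commute)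
  qed
  \<comment> \<open>For \<open>m = 0\<close> only the empty set is left, where a function of sum
    zero vanishes. Hence nonzero balanced functions require \<open>k \<ge> 2\<close>.\<close>
  have "m \<noteq> 0"
  proof
    assume "m = 0"
    then have "\<forall>x\<in>nsets Y m. \<psi> a b x = \<psi> a b z" using z by auto
    then show False using zero[OF _ z(1)[folded Y_def] finY sum1] z(2) by blast
  qed
  then obtain j where j: "m = Suc j" using not0_implies_Suc by blast
  have "\<exists>c d w. c \<in> Y \<and> d \<in> Y \<and> c \<noteq> d \<and> w \<in> nsets (Y - {c, d}) j \<and> \<psi> a b (insert c w) - \<psi> a b (insert d w) \<noteq> 0"
  proof (rule ccontr)
    assume no: "\<not> ?thesis"
    have "\<psi> a b (insert c w) = \<psi> a b (insert d w)"
      if "c \<in> Y" "d \<in> Y" "c \<noteq> d" "w \<in> nsets (Y - {c, d}) j" for c d w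
    proof -
      have "\<psi> a b (insert c w) - \<psi> a b (insert d w) = 0" using no that by blast
      then show ?thesis by simp
    qed
    then have "\<forall>x\<in>nsets Y m. \<psi> a b x = \<psi> a b z"
      using swap_invariant_constant[OF finY, of j "\<psi> a b" _ z] z(1)[folded Y_def] unfolding j by blast
    then show False using zero[OF _ z(1)[folded Y_def] finY sum1] z(2) by blast
  qed
  then obtain c d w where cd: "c \<in> Y" "d \<in> Y" "c \<noteq> d" and w: "w \<in> nsets (Y - {c, d}) j"
    "\<psi> a b (insert c w) - \<psi> a b (insert d w) \<noteq> 0" by auto
  \<comment> \<open>The two sign changes cancel, and the remaining graph on \<open>n - 4\<close>
    points has degree \<open>C((n - 4) - (k - 2), k - 2)\<close>.\<close>
  have "kneser (Y - {c, d}) j (\<lambda>w. \<psi> a b (insert c w) - \<psi> a b (insert d w)) w =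
      - (- \<theta>) * (\<psi> a b (insert c w) - \<psi> a b (insert d w))" if "w \<in> nsets (Y - {c, d}) j" for w
    by (rule kneser_swap_difference[OF finY cd]) (use eig1 j that in auto)
  then have "\<bar>\<theta>\<bar> \<le> real ((card (Y - {c, d}) - j) choose j)"
    using w finY by (intro kneser_eigenvalue_bound[where \<phi> = "\<lambda>w. \<psi> a b (insert c w) - \<psi> a b (insert d w)" and x\<^sub>0 = w]) auto
  moreover have "card (Y - {c, d}) - j = card X - k - 2" "j = k - 2" "k \<ge> 2"
    using cd finY cardY m j by (auto simp: card_Diff_subset)
  ultimately show ?thesis by simp
qed

lemma sum_indicator_real:
  "finite A \<Longrightarrow> (\<Sum>x\<in>A. indicator B x) = real (card (A \<inter> B))"
  by (simp add: indicator_def sum.If_cases)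

text \<open>The left side counts ordered disjoint pairs. As \<open>k > 0\<close>, no member is
  disjoint from itself, so each unordered pair occurs exactly twice.\<close>

lemma sum_indicator_disjoint_pairs:
  assumes fin: "finite X" and k: "k > 0" and F: "\<F> \<subseteq> nsets X k"
  shows "(\<Sum>x\<in>nsets X k. indicator \<F> x * kneser X k (indicator \<F>) x) = 2 * real (dp \<F>)"
proof -
  define O2 where "O2 = {(x, y). x \<in> \<F> \<and> y \<in> \<F> \<and> x \<inter> y = {}}"
  define g where "g = (\<lambda>(x, y). {x, y :: 'a set})"
  have finN: "finite (nsets X k)" using fin by (rule finite_imp_finite_nsets)
  then have finF: "finite \<F>" using F finite_subset by blast
  have finO: "finite O2" by (rule finite_subset[of _ "\<F> \<times> \<F>"]) (use finF in \<open>auto simp: O2_def\<close>)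
  have ne: "x \<noteq> y" if "(x, y) \<in> O2" for x y
  proof
    assume "x = y"
    then have "x = {}" using that by (auto simp: O2_def)
    then show False using that F k by (auto simp: O2_def nsets_def)
  qed
  have img: "g ` O2 = {{F, G} | F G. F \<in> \<F> \<and> G \<in> \<F> \<and> F \<noteq> G \<and> F \<inter> G = {}}"
  proof -
    have "g ` O2 = {{F, G} | F G. (F, G) \<in> O2}" by (auto simp: g_def)
    also have "\<dots> = {{F, G} | F G. F \<in> \<F> \<and> G \<in> \<F> \<and> F \<noteq> G \<and> F \<inter> G = {}}"
    proof -
      have "(F, G) \<in> O2 \<longleftrightarrow> F \<in> \<F> \<and> G \<in> \<F> \<and> F \<noteq> G \<and> F \<inter> G = {}" for F G
        using ne[of F G] by (auto simp: O2_def)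
      then show ?thesis by simp
    qed
    finally show ?thesis .
  qed
  have fib: "card {p \<in> O2. g p = e} = 2" if e: "e \<in> g ` O2" for e
  proof -
    obtain x y where xy: "(x, y) \<in> O2" "e = {x, y}" using e by (auto simp: g_def)
    then have "{p \<in> O2. g p = e} = {(x, y), (y, x)}"
      by (auto simp: g_def O2_def doubleton_eq_iff)
    then show ?thesis using ne[OF xy(1)] by simp
  qed
  have "card O2 = (\<Sum>e\<in>g ` O2. card {p \<in> O2. g p = e})"
    using sum.image_gen[OF finO, of "\<lambda>_. 1 :: nat" g] by simp
  also have "\<dots> = 2 * dp \<F>" using fib by (simp add: dp_def img)
  finally have card: "card O2 = 2 * dp \<F>" .
  have "(\<Sum>x\<in>nsets X k. indicator \<F> x * kneser X k (indicator \<F>) x) = (\<Sum>x\<in>\<F>. kneser X k (indicator \<F>) x)"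
    using finN F by (simp add: indicator_def if_distrib[of "\<lambda>c. c * _"] sum.If_cases Int_absorb1 cong: if_cong)
  also have "\<dots> = (\<Sum>x\<in>\<F>. real (card {y \<in> \<F>. x \<inter> y = {}}))"
  proof (rule sum.cong[OF refl])
    fix x
    have "kneser X k (indicator \<F>) x = real (card ({y. y \<in> nsets X k \<and> y \<inter> x = {}} \<inter> \<F>))"
      unfolding kneser_def using finN by (subst sum_indicator_real) auto
    also have "{y. y \<in> nsets X k \<and> y \<inter> x = {}} \<inter> \<F> = {y \<in> \<F>. x \<inter> y = {}}" using F by auto
    finally show "kneser X k (indicator \<F>) x = real (card {y \<in> \<F>. x \<inter> y = {}})" .
  qed
  also have "\<dots> = real (card (SIGMA x:\<F>. {y \<in> \<F>. x \<inter> y = {}}))"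
    using finF by (subst card_SigmaI) auto
  also have "(SIGMA x:\<F>. {y \<in> \<F>. x \<inter> y = {}}) = O2" by (auto simp: O2_def)
  finally show ?thesis using card by simp
qed

section \<open>Linear functions on the slice and the spectral gap\<close>

locale slice =
  fixes X :: "'a set" and k :: nat
  assumes finX: "finite X" and kpos: "k > 0" and kn: "2 * k < card X"
begin

abbreviation Sl :: "'a set set" where "Sl \<equiv> nsets X k"

definition N :: real where "N = real (card X)"
definition K :: real where "K = real k"
text \<open>The size of a star, the unit in which all distances are measured.\<close>

definition M :: real where "M = real ((card X - 1) choose (k - 1))"
text \<open>The number of members of a star that are disjoint from a given \<open>k\<close>-set
  avoiding the centre.\<close>

definition mu :: real where "mu = real ((card X - k - 1) choose (k - 1))"
definition lin :: "('a \<Rightarrow> real) \<Rightarrow> 'a set \<Rightarrow> real" where "lin a x = (\<Sum>i\<in>x. a i)"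

lemma finite_Sl: "finite Sl"
  using finX by (rule finite_imp_finite_nsets)

lemma K_ge_1: "K \<ge> 1" and N_gt: "N > 2 * K"
  using kpos kn by (auto simp: K_def N_def)

lemma M_pos: "M > 0" and mu_pos: "mu > 0"
  using kpos kn by (auto simp: M_def mu_def)

lemma card_star:
  assumes "i \<in> X"
  shows "real (card {x \<in> Sl. i \<in> x}) = M"
  using card_nsets_containing[OF finX assms, of "k - 1"] kpos by (simp add: M_def)

lemma card_star_inter:
  assumes ij: "i \<in> X" "j \<in> X" "i \<noteq> j"
  shows "real (card {x \<in> Sl. i \<in> x \<and> j \<in> x}) = M * (K - 1) / (N - 1)"
proof -
  obtain m where m: "k = Suc m" using kpos gr0_implies_Suc by blast
  have fin': "finite (X - {i})" "j \<in> X - {i}" using finX ij by auto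
  have "real (card {x \<in> Sl. i \<in> x \<and> j \<in> x}) = (\<Sum>x | x \<in> nsets X (Suc m) \<and> i \<in> x \<and> j \<in> x. 1)"
    by (simp add: m)
  also have "\<dots> = (\<Sum>z | z \<in> nsets (X - {i}) m \<and> j \<in> insert i z. 1)"
    by (rule sum_nsets_containing[OF finX ij(1)])
  also have "{z. z \<in> nsets (X - {i}) m \<and> j \<in> insert i z} = {z \<in> nsets (X - {i}) m. j \<in> z}"
    using ij by auto
  finally have eq: "real (card {x \<in> Sl. i \<in> x \<and> j \<in> x}) = real (card {z \<in> nsets (X - {i}) m. j \<in> z})"
    by simp
  show ?thesis
  proof (cases m)
    case 0
    then have "{z \<in> nsets (X - {i}) m. j \<in> z} = {}" by (auto simp: nsets_def)
    then have "card {z \<in> nsets (X - {i}) m. j \<in> z} = 0" by (metis card.empty)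
    then have "real (card {x \<in> Sl. i \<in> x \<and> j \<in> x}) = 0" using eq by simp
    moreover have "K = 1" using 0 m unfolding K_def by simp
    ultimately show ?thesis by simp
  next
    case (Suc r)
    have "card {z \<in> nsets (X - {i}) m. j \<in> z} = (card (X - {i}) - 1) choose r"
      unfolding Suc by (rule card_nsets_containing[OF fin'])
    also have "card (X - {i}) - 1 = card X - 2" using finX ij by simp
    finally have c: "card {z \<in> nsets (X - {i}) m. j \<in> z} = (card X - 2) choose r" .
    have "m * ((card X - 1) choose m) = (card X - 1) * ((card X - 2) choose r)"
      using binomial_absorption[of r "card X - 1"] Suc by (simp add: numeral_2_eq_2)
    moreover have "M = real ((card X - 1) choose m)" using m unfolding M_def by simp
    moreover have "N - 1 = real (card X - 1)" using kn by (simp add: N_def of_nat_diff)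
    ultimately have "real m * M = (N - 1) * real ((card X - 2) choose r)" by (metis of_nat_mult)
    moreover have "K - 1 = real m" using m unfolding K_def by simp
    moreover have "N - 1 > 0" using K_ge_1 N_gt by linarith
    ultimately show ?thesis using eq c by (simp add: field_simps)
  qed
qed

lemma card_Sl: "K * real (card Sl) = N * M"
proof -
  have "k * (card X choose k) = card X * ((card X - 1) choose (k - 1))"
    using binomial_absorption[of "k - 1" "card X"] kpos by simp
  then show ?thesis unfolding K_def N_def M_def card_nsets_finite[OF finX] by (metis of_nat_mult)
qed

lemma card_star_disjoint:
  assumes "x \<in> Sl" "i \<in> X"
  shows "real (card {y \<in> Sl. i \<in> y \<and> y \<inter> x = {}}) = (if i \<in> x then 0 else mu)"
proof (cases "i \<in> x")
  case True
  then have e: "{y \<in> Sl. i \<in> y \<and> y \<inter> x = {}} = {}" by auto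
  show ?thesis unfolding e using True by simp
next
  case False
  have e: "{y \<in> Sl. i \<in> y \<and> y \<inter> x = {}} = {y \<in> nsets (X - x) (Suc (k - 1)). i \<in> y}"
    using kpos by (auto simp: nsets_def)
  have "card (X - x) = card X - k" using assms finX by (simp add: nsets_def card_Diff_subset)
  moreover have "card {y \<in> nsets (X - x) (Suc (k - 1)). i \<in> y} = (card (X - x) - 1) choose (k - 1)"
    using finX assms False by (intro card_nsets_containing) auto
  ultimately show ?thesis unfolding e using False by (simp add: mu_def)
qed

lemma sum_mult_lin:
  "(\<Sum>x\<in>Sl. \<phi> x * lin a x) = (\<Sum>i\<in>X. a i * (\<Sum>x | x \<in> Sl \<and> i \<in> x. \<phi> x))"
  unfolding lin_def sum_nsets_by_element[OF finX, symmetric]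
  by (simp add: sum_distrib_left mult.commute)

lemma sum_restrict_lin:
  "(\<Sum>x | x \<in> Sl \<and> P x. lin a x) = (\<Sum>i\<in>X. a i * real (card {x \<in> Sl. i \<in> x \<and> P x}))"
proof -
  have "(\<Sum>x | x \<in> Sl \<and> P x. lin a x) = (\<Sum>x\<in>Sl. (if P x then 1 else 0) * lin a x)"
    using finite_Sl by (intro sum.mono_neutral_cong_left) auto
  also have "\<dots> = (\<Sum>i\<in>X. a i * (\<Sum>x | x \<in> Sl \<and> i \<in> x. if P x then 1 else 0))"
    by (rule sum_mult_lin)
  also have "\<dots> = (\<Sum>i\<in>X. a i * real (card {x \<in> Sl. i \<in> x \<and> P x}))"
    using finite_Sl by (intro sum.cong refl) (simp add: sum.If_cases Collect_conj_eq Int_assoc)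
  finally show ?thesis .
qed

lemma sum_lin: "(\<Sum>x\<in>Sl. lin a x) = M * (\<Sum>i\<in>X. a i)"
  using sum_restrict_lin[where P = "\<lambda>_. True" and a = a] by (simp add: card_star sum_distrib_right mult.commute[of M])

text \<open>Among the sets containing \<open>i\<close>, the term \<open>a i\<close> always occurs
  and every other \<open>a j\<close> in the proportion \<open>(K - 1) / (N - 1)\<close>. The matrix
  of star sums is thus a combination of the identity and the all-ones matrix, which is easily
  inverted.\<close>

lemma sum_star_lin:
  assumes i: "i \<in> X"
  shows "(\<Sum>x | x \<in> Sl \<and> i \<in> x. lin a x) =
    M * (N - K) / (N - 1) * a i + M * (K - 1) / (N - 1) * (\<Sum>j\<in>X. a j)"
proof -
  have N1: "N - 1 > 0" using K_ge_1 N_gt by linarith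
  have alg: "(d + c) * y + (s - y) * c = d * y + c * s" for c d y s :: real
    by (simp add: algebra_simps)
  have "(\<Sum>x | x \<in> Sl \<and> i \<in> x. lin a x) = (\<Sum>j\<in>X. a j * real (card {x \<in> Sl. j \<in> x \<and> i \<in> x}))"
    by (rule sum_restrict_lin)
  also have "\<dots> = a i * M + (\<Sum>j\<in>X - {i}. a j * (M * (K - 1) / (N - 1)))"
    using finX i by (subst sum.remove[OF finX i]) (auto simp: card_star card_star_inter)
  also have "\<dots> = a i * M + (\<Sum>j\<in>X - {i}. a j) * (M * (K - 1) / (N - 1))"
    by (simp only: sum_distrib_right)
  also have "(\<Sum>j\<in>X - {i}. a j) = (\<Sum>j\<in>X. a j) - a i"
    using finX i by (simp add: sum_diff1)
  also have "a i * M = (M * (N - K) / (N - 1) + M * (K - 1) / (N - 1)) * a i"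
  proof -
    have "M * (N - K) / (N - 1) + M * (K - 1) / (N - 1) = M * (N - 1) / (N - 1)"
      unfolding add_divide_distrib[symmetric] by (simp add: algebra_simps)
    then show ?thesis using N1 by simp
  qed
  finally show ?thesis by (simp only: alg)
qed

text \<open>A point outside \<open>x\<close> lies in \<open>mu\<close> of the sets disjoint from
  \<open>x\<close>, a point inside in none. Hence linear functions are an invariant space, with
  eigenvalue \<open>- mu\<close> when the coefficients sum to zero.\<close>

lemma kneser_lin:
  assumes "x \<in> Sl"
  shows "kneser X k (lin a) x = mu * ((\<Sum>i\<in>X. a i) - lin a x)"
proof -
  have "kneser X k (lin a) x = (\<Sum>i\<in>X. a i * real (card {y \<in> Sl. i \<in> y \<and> y \<inter> x = {}}))"
    unfolding kneser_def by (rule sum_restrict_lin)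
  also have "\<dots> = (\<Sum>i\<in>X. mu * a i - mu * (if i \<in> x then a i else 0))"
    using assms by (intro sum.cong refl) (simp add: card_star_disjoint)
  also have "\<dots> = mu * (\<Sum>i\<in>X. a i) - mu * (\<Sum>i\<in>X. if i \<in> x then a i else 0)"
    by (simp add: sum_subtractf sum_distrib_left)
  also have "(\<Sum>i\<in>X. if i \<in> x then a i else 0) = lin a x"
    using assms finX by (simp add: sum.If_cases lin_def Int_absorb1 nsets_def)
  finally show ?thesis by (simp add: algebra_simps)
qed

lemma kneser_sum: "kneser X k \<phi> x = (\<Sum>y\<in>Sl. (if y \<inter> x = {} then 1 else 0) * \<phi> y)"
  unfolding kneser_def using finite_Sl by (intro sum.mono_neutral_cong_left) auto

lemma kneser_selfadjoint:
  "(\<Sum>x\<in>Sl. \<psi> x * kneser X k \<phi> x) = (\<Sum>x\<in>Sl. \<phi> x * kneser X k \<psi> x)"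
  unfolding kneser_sum sum_distrib_left
  by (subst sum.swap) (simp add: Int_commute mult_ac)

text \<open>The orthogonal complement of the linear functions, expressed by star sums because the
  star indicators span them. Constants are linear on the slice, so balanced functions also have sum
  zero.\<close>

definition balanced :: "('a set \<Rightarrow> real) \<Rightarrow> bool" where
  "balanced \<phi> \<longleftrightarrow> (\<forall>i\<in>X. (\<Sum>x | x \<in> Sl \<and> i \<in> x. \<phi> x) = 0)"

lemma balanced_orthogonal_lin: "balanced \<phi> \<Longrightarrow> (\<Sum>x\<in>Sl. \<phi> x * lin a x) = 0"
  unfolding sum_mult_lin balanced_def by simp

lemma balanced_sum: "balanced \<phi> \<Longrightarrow> (\<Sum>x\<in>Sl. \<phi> x) = 0"
proof -
  assume "balanced \<phi>"
  then have "0 = (\<Sum>x\<in>Sl. \<phi> x * lin (\<lambda>_. 1) x)" by (simp add: balanced_orthogonal_lin)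
  also have "\<dots> = (\<Sum>x\<in>Sl. \<phi> x) * K"
    unfolding sum_distrib_right by (intro sum.cong refl) (simp add: lin_def K_def nsets_def)
  finally show ?thesis using K_ge_1 by simp
qed

lemma sum_star_eq: "(\<Sum>x | x \<in> Sl \<and> i \<in> x. \<phi> x) = (\<Sum>x\<in>Sl. (if i \<in> x then 1 else 0) * \<phi> x)"
  for \<phi> :: "'a set \<Rightarrow> real"
  using finite_Sl by (intro sum.mono_neutral_cong_left) auto

text \<open>The operator is self-adjoint and preserves linear functions, so it preserves their
  orthogonal complement. The coefficients \<open>e\<close> are those of a star indicator.\<close>

lemma kneser_balanced:
  assumes "balanced \<phi>"
  shows "balanced (kneser X k \<phi>)"
  unfolding balanced_def
proof
  fix i assume i: "i \<in> X"
  define e where "e j = (if j = i then 1 else 0 :: real)" for j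
  have le: "lin e x = (if i \<in> x then 1 else 0)" if "x \<in> Sl" for x
    using that by (simp add: lin_def e_def nsets_def)
  have "(\<Sum>x | x \<in> Sl \<and> i \<in> x. kneser X k \<phi> x) = (\<Sum>x\<in>Sl. lin e x * kneser X k \<phi> x)"
    unfolding sum_star_eq using le by simp
  also have "\<dots> = (\<Sum>x\<in>Sl. \<phi> x * kneser X k (lin e) x)" by (rule kneser_selfadjoint)
  also have "\<dots> = (\<Sum>x\<in>Sl. mu * (\<Sum>i\<in>X. e i) * \<phi> x - mu * (\<phi> x * lin e x))"
    by (intro sum.cong refl) (simp add: kneser_lin algebra_simps)
  also have "\<dots> = 0"
    unfolding sum_subtractf sum_distrib_left[symmetric] using assms by (simp add: balanced_sum balanced_orthogonal_lin)
  finally show "(\<Sum>x | x \<in> Sl \<and> i \<in> x. kneser X k \<phi> x) = 0" .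
qed

text \<open>The eigenvalue bound is expressed as a multiple of \<open>mu\<close>, so that the gap
  \<open>1 - (K - 1) / (N - K - 1) = (N - 2 * K) / (N - K - 1)\<close> can be read off.\<close>

lemma kneser_form_balanced:
  assumes bal: "balanced \<phi>"
  shows "(\<Sum>x\<in>Sl. \<phi> x * kneser X k \<phi> x) \<ge> - (mu * (K - 1) / (N - K - 1)) * (\<Sum>x\<in>Sl. (\<phi> x)\<^sup>2)"
proof (cases "\<exists>x\<in>Sl. \<phi> x \<noteq> 0")
  case False
  then show ?thesis by simp
next
  case True
  then obtain x\<^sub>0 where x0: "x\<^sub>0 \<in> Sl" "\<phi> x\<^sub>0 \<noteq> 0" by auto
  define B where "B x y = (if y \<inter> x = {} then 1 else 0 :: real)" for x y :: "'a set"
  have Bk: "(\<Sum>y\<in>Sl. B x y * \<psi> y) = kneser X k \<psi> x" for \<psi> x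
    by (simp add: B_def kneser_sum)
  have Bq: "(\<Sum>x\<in>Sl. \<Sum>y\<in>Sl. B x y * \<psi> x * \<psi> y) = (\<Sum>x\<in>Sl. \<psi> x * kneser X k \<psi> x)" for \<psi>
    unfolding Bk[symmetric] sum_distrib_left by (simp add: mult_ac)
  obtain \<theta> \<psi> where \<psi>: "balanced \<psi>" "\<exists>x\<in>Sl. \<psi> x \<noteq> 0" "\<And>x. x \<in> Sl \<Longrightarrow> kneser X k \<psi> x = \<theta> * \<psi> x"
    and ge: "\<And>\<psi>. balanced \<psi> \<Longrightarrow> (\<Sum>x\<in>Sl. \<psi> x * kneser X k \<psi> x) \<ge> \<theta> * (\<Sum>x\<in>Sl. (\<psi> x)\<^sup>2)"
  proof (rule rayleigh_eigenvector[OF finite_Sl, of B balanced X "\<lambda>i x. if i \<in> x then 1 else 0" \<phi> x\<^sub>0, unfolded Bk Bq])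
    show "B x y = B y x" for x y by (simp add: B_def Int_commute)
    show "balanced \<phi> = (\<forall>i\<in>X. (\<Sum>x\<in>Sl. (if i \<in> x then 1 else 0) * \<phi> x) = 0)" for \<phi>
      by (simp add: balanced_def sum_star_eq)
  qed (use x0 bal kneser_balanced in auto)
  obtain x\<^sub>1 where x1: "x\<^sub>1 \<in> Sl" "\<psi> x\<^sub>1 \<noteq> 0" using \<psi>(2) by auto
  have *: "k \<ge> 2 \<and> \<bar>\<theta>\<bar> \<le> real ((card X - k - 2) choose (k - 2))"
    using \<psi>(1) x1 by (intro kneser_eigenvalue_bound_balanced[OF finX kpos \<psi>(3)]) (auto simp: balanced_def)
  have "(k - 1) * ((card X - k - 1) choose (k - 1)) = (card X - k - 1) * ((card X - k - 2) choose (k - 2))"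
  proof -
    have "Suc (k - 2) = k - 1" "card X - k - 1 - 1 = card X - k - 2" using * by auto
    then show ?thesis using binomial_absorption[of "k - 2" "card X - k - 1"] by metis
  qed
  then have "real (k - 1) * mu = real (card X - k - 1) * real ((card X - k - 2) choose (k - 2))"
    unfolding mu_def by (metis of_nat_mult)
  moreover have "real (k - 1) = K - 1" "real (card X - k - 1) = N - K - 1"
    using kpos kn by (auto simp: K_def N_def of_nat_diff)
  ultimately have "(K - 1) * mu = (N - K - 1) * real ((card X - k - 2) choose (k - 2))" by (simp only:)
  moreover have "N - K - 1 \<noteq> 0" using N_gt K_ge_1 by linarith
  ultimately have "real ((card X - k - 2) choose (k - 2)) = mu * (K - 1) / (N - K - 1)"
    by (metis mult.commute nonzero_mult_div_cancel_left)
  with * have "- (mu * (K - 1) / (N - K - 1)) \<le> \<theta>" by linarith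
  then have "- (mu * (K - 1) / (N - K - 1)) * (\<Sum>x\<in>Sl. (\<phi> x)\<^sup>2) \<le> \<theta> * (\<Sum>x\<in>Sl. (\<phi> x)\<^sup>2)"
    by (intro mult_right_mono sum_nonneg) auto
  also have "\<dots> \<le> (\<Sum>x\<in>Sl. \<phi> x * kneser X k \<phi> x)" by (rule ge[OF bal])
  finally show ?thesis .
qed

lemma linear_projection:
  obtains a where "balanced (\<lambda>x. f x - lin a x)" "M * (\<Sum>i\<in>X. a i) = (\<Sum>x\<in>Sl. f x)"
proof -
  define s where "s = (\<Sum>x\<in>Sl. f x) / M"
  define d where "d i = (\<Sum>x | x \<in> Sl \<and> i \<in> x. f x)" for i
  \<comment> \<open>The solution of the star equations given by \<open>sum_star_lin\<close>. The
    total \<open>s\<close> of the coefficients is known beforehand, because the difference to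
    \<open>f\<close> must have sum zero.\<close>
  define a where "a i = (d i - M * (K - 1) / (N - 1) * s) / (M * (N - K) / (N - 1))" for i
  have pos: "N - 1 > 0" "N - K > 0" "M > 0" using K_ge_1 N_gt M_pos by auto
  have "(\<Sum>i\<in>X. d i) = (\<Sum>x\<in>Sl. f x * lin (\<lambda>_. 1) x)"
    unfolding sum_mult_lin by (simp add: d_def)
  also have "\<dots> = (\<Sum>x\<in>Sl. f x * K)"
    by (intro sum.cong refl) (simp add: lin_def K_def nsets_def)
  also have "\<dots> = K * (M * s)" using pos by (simp add: s_def sum_distrib_right[symmetric])
  finally have sd: "(\<Sum>i\<in>X. d i) = K * (M * s)" .
  have "(\<Sum>i\<in>X. a i) = (K * (M * s) - N * (M * (K - 1) / (N - 1) * s)) / (M * (N - K) / (N - 1))"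
    unfolding a_def sum_divide_distrib[symmetric] sum_subtractf sd by (simp add: N_def)
  also have "K * (M * s) - N * (M * (K - 1) / (N - 1) * s) = M * (N - K) / (N - 1) * s"
    using pos by (simp add: field_simps)
  finally have sa: "(\<Sum>i\<in>X. a i) = s" using pos by simp
  have "balanced (\<lambda>x. f x - lin a x)"
    unfolding balanced_def
  proof
    fix i assume i: "i \<in> X"
    have "(\<Sum>x | x \<in> Sl \<and> i \<in> x. f x - lin a x) =
      d i - (M * (N - K) / (N - 1) * a i + M * (K - 1) / (N - 1) * s)"
      by (simp add: sum_subtractf d_def sum_star_lin[OF i] sa)
    also have "\<dots> = 0" using pos by (simp add: a_def)
    finally show "(\<Sum>x | x \<in> Sl \<and> i \<in> x. f x - lin a x) = 0" .
  qed
  moreover have "M * (\<Sum>i\<in>X. a i) = (\<Sum>x\<in>Sl. f x)" using sa pos by (simp add: s_def)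
  ultimately show thesis by (rule that)
qed

lemma kneser_add: "kneser X k (\<lambda>y. \<phi> y + \<psi> y) x = kneser X k \<phi> x + kneser X k \<psi> x"
  by (simp add: kneser_def sum.distrib)

text \<open>A stability form of the Hoffman bound. With \<open>f = \<phi> + lin a\<close> the cross
  terms vanish, and the linear part contributes \<open>mu * (c\<^sup>2 / M - c + q)\<close> since
  its squared norm is \<open>c - q\<close>. Mass \<open>q\<close> off the linear functions thus
  costs \<open>mu * q\<close>, of which the balanced part returns at most the fraction
  \<open>(K - 1) / (N - K - 1)\<close>.\<close>

lemma few_disjoint_pairs_near_linear:
  assumes F: "\<F> \<subseteq> Sl"
  obtains a where "mu * (N - 2 * K) / (N - K - 1) * (\<Sum>x\<in>Sl. (indicator \<F> x - lin a x)\<^sup>2)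
    \<le> 2 * real (dp \<F>) - mu * ((real (card \<F>))\<^sup>2 / M - real (card \<F>))"
proof -
  define f where "f = (indicator \<F> :: 'a set \<Rightarrow> real)"
  obtain a where bal: "balanced (\<lambda>x. f x - lin a x)" and sum_a: "M * (\<Sum>i\<in>X. a i) = (\<Sum>x\<in>Sl. f x)"
    by (rule linear_projection)
  define \<phi> where "\<phi> x = f x - lin a x" for x
  have bal': "balanced \<phi>" using bal unfolding \<phi>_def .
  define s where "s = (\<Sum>i\<in>X. a i)"
  define q where "q = (\<Sum>x\<in>Sl. (\<phi> x)\<^sup>2)"
  define c where "c = real (card \<F>)"
  have sumf: "(\<Sum>x\<in>Sl. f x) = c"
    unfolding f_def c_def using F finite_Sl by (simp add: sum_indicator_real Int_absorb1)
  have ff: "(\<Sum>x\<in>Sl. (f x)\<^sup>2) = c"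
    unfolding sumf[symmetric] by (intro sum.cong refl) (simp add: f_def indicator_def)
  have s: "s = c / M" using sum_a sumf M_pos by (simp add: s_def field_simps)
  have \<phi>l: "(\<Sum>x\<in>Sl. \<phi> x * lin a x) = 0" by (rule balanced_orthogonal_lin[OF bal'])
  have "(\<Sum>x\<in>Sl. (f x)\<^sup>2) = q + 2 * (\<Sum>x\<in>Sl. \<phi> x * lin a x) + (\<Sum>x\<in>Sl. (lin a x)\<^sup>2)"
    unfolding q_def sum_distrib_left sum.distrib[symmetric]
    by (intro sum.cong refl) (simp add: \<phi>_def power2_eq_square algebra_simps)
  then have ll: "(\<Sum>x\<in>Sl. (lin a x)\<^sup>2) = c - q" using ff \<phi>l by simp
  have kl: "(\<Sum>x\<in>Sl. \<psi> x * kneser X k (lin a) x) = mu * (s * (\<Sum>x\<in>Sl. \<psi> x) - (\<Sum>x\<in>Sl. \<psi> x * lin a x))" for \<psi>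
  proof -
    have "(\<Sum>x\<in>Sl. \<psi> x * kneser X k (lin a) x) = (\<Sum>x\<in>Sl. mu * s * \<psi> x - mu * (\<psi> x * lin a x))"
      by (intro sum.cong refl) (simp add: kneser_lin s_def algebra_simps)
    then show ?thesis unfolding sum_subtractf sum_distrib_left[symmetric] by (simp add: algebra_simps)
  qed
  have fk: "kneser X k f x = kneser X k \<phi> x + kneser X k (lin a) x" for x
    unfolding kneser_add[symmetric] by (simp add: \<phi>_def)
  have "2 * real (dp \<F>) = (\<Sum>x\<in>Sl. f x * kneser X k f x)"
    unfolding f_def by (rule sum_indicator_disjoint_pairs[OF finX kpos F, symmetric])
  also have "\<dots> = (\<Sum>x\<in>Sl. \<phi> x * kneser X k \<phi> x) + (\<Sum>x\<in>Sl. lin a x * kneser X k \<phi> x) +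
      (\<Sum>x\<in>Sl. \<phi> x * kneser X k (lin a) x) + (\<Sum>x\<in>Sl. lin a x * kneser X k (lin a) x)"
    unfolding sum.distrib[symmetric] fk
    by (intro sum.cong refl) (simp add: \<phi>_def algebra_simps)
  also have "(\<Sum>x\<in>Sl. lin a x * kneser X k \<phi> x) = (\<Sum>x\<in>Sl. \<phi> x * kneser X k (lin a) x)"
    by (rule kneser_selfadjoint)
  also have "(\<Sum>x\<in>Sl. \<phi> x * kneser X k (lin a) x) = 0"
    unfolding kl using \<phi>l balanced_sum[OF bal'] by simp
  also have "(\<Sum>x\<in>Sl. lin a x * kneser X k (lin a) x) = mu * (s * c - (c - q))"
    unfolding kl using ll sum_a by (simp add: sum_lin sumf power2_eq_square)
  finally have main: "2 * real (dp \<F>) = (\<Sum>x\<in>Sl. \<phi> x * kneser X k \<phi> x) + mu * (c\<^sup>2 / M - c) + mu * q"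
    by (simp add: s power2_eq_square algebra_simps)
  have pos: "N - K - 1 > 0" using N_gt K_ge_1 by linarith
  have "mu * (N - 2 * K) / (N - K - 1) * q = mu * q - mu * (K - 1) / (N - K - 1) * q"
    using pos by (simp add: field_simps)
  also have "\<dots> \<le> 2 * real (dp \<F>) - mu * (c\<^sup>2 / M - c)"
    using main kneser_form_balanced[OF bal'] by (simp add: q_def)
  finally show thesis using that[of a] by (simp add: q_def \<phi>_def f_def c_def)
qed

end

section \<open>Rounding the coefficients of the linear part\<close>

lemma permutation_extending_injection:
  assumes fin: "finite X" and Y: "Y \<subseteq> X" "inj_on c Y" "c ` Y \<subseteq> X"
  obtains \<pi> where "\<pi> permutes X" "\<And>i. i \<in> Y \<Longrightarrow> \<pi> i = c i"
proof -
  have fY: "finite Y" using fin Y finite_subset by blast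
  have "card (X - Y) = card (X - c ` Y)"
    using fin fY Y by (simp add: card_Diff_subset card_image)
  then obtain g where g: "bij_betw g (X - Y) (X - c ` Y)"
    using fin finite_same_card_bij[of "X - Y" "X - c ` Y"] by auto
  define \<pi> where "\<pi> i = (if i \<in> Y then c i else if i \<in> X then g i else i)" for i
  have "bij_betw \<pi> Y (c ` Y)"
    using Y(2) by (auto simp: bij_betw_def \<pi>_def inj_on_def)
  moreover have "bij_betw \<pi> (X - Y) (X - c ` Y)"
    using g by (subst bij_betw_cong[of _ _ g]) (auto simp: \<pi>_def)
  ultimately have "bij_betw \<pi> (Y \<union> (X - Y)) (c ` Y \<union> (X - c ` Y))"
    by (rule bij_betw_combine) auto
  moreover have "Y \<union> (X - Y) = X" "c ` Y \<union> (X - c ` Y) = X" using Y by auto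
  ultimately have "bij_betw \<pi> X X" by simp
  then have "\<pi> permutes X" using Y by (intro bij_imp_permutes) (auto simp: \<pi>_def)
  then show thesis using that[of \<pi>] by (auto simp: \<pi>_def)
qed

text \<open>Replacing \<open>\<sigma>\<close> by \<open>\<sigma> \<circ> \<pi>\<close> shows that
  the sum over permutations does not depend on the starting point; when all starting points are
  summed, each \<open>\<sigma>\<close> merely permutes \<open>Z\<close>.\<close>

lemma sum_permutations_transitive:
  fixes act :: "('a \<Rightarrow> 'a) \<Rightarrow> 'z \<Rightarrow> 'z" and \<phi> :: "'z \<Rightarrow> real"
  assumes finX: "finite X" and finZ: "finite Z" and z0: "z\<^sub>0 \<in> Z"
    and maps: "\<And>\<sigma> z. \<sigma> permutes X \<Longrightarrow> z \<in> Z \<Longrightarrow> act \<sigma> z \<in> Z"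
    and inj: "\<And>\<sigma>. \<sigma> permutes X \<Longrightarrow> inj_on (act \<sigma>) Z"
    and comp: "\<And>\<sigma> \<pi> z. act (\<sigma> \<circ> \<pi>) z = act \<sigma> (act \<pi> z)"
    and trans: "\<And>z. z \<in> Z \<Longrightarrow> \<exists>\<pi>. \<pi> permutes X \<and> act \<pi> z\<^sub>0 = z"
  shows "real (card Z) * (\<Sum>\<sigma> | \<sigma> permutes X. \<phi> (act \<sigma> z\<^sub>0)) = fact (card X) * (\<Sum>z\<in>Z. \<phi> z)"
proof -
  have eq: "(\<Sum>\<sigma> | \<sigma> permutes X. \<phi> (act \<sigma> z)) = (\<Sum>\<sigma> | \<sigma> permutes X. \<phi> (act \<sigma> z\<^sub>0))" if z: "z \<in> Z" for z
  proof -
    obtain \<pi> where \<pi>: "\<pi> permutes X" "act \<pi> z\<^sub>0 = z" using trans[OF z] by blast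
    have "(\<Sum>\<sigma> | \<sigma> permutes X. \<phi> (act \<sigma> z\<^sub>0)) = (\<Sum>\<sigma> | \<sigma> permutes X. \<phi> (act (\<sigma> \<circ> \<pi>) z\<^sub>0))"
      by (rule sum_permutations_compose_right[OF \<pi>(1)])
    then show ?thesis by (simp add: comp \<pi>(2))
  qed
  have "real (card Z) * (\<Sum>\<sigma> | \<sigma> permutes X. \<phi> (act \<sigma> z\<^sub>0)) = (\<Sum>z\<in>Z. \<Sum>\<sigma> | \<sigma> permutes X. \<phi> (act \<sigma> z))"
    by (simp add: eq)
  also have "\<dots> = (\<Sum>\<sigma> | \<sigma> permutes X. \<Sum>z\<in>Z. \<phi> (act \<sigma> z))" by (rule sum.swap)
  also have "\<dots> = (\<Sum>\<sigma> | \<sigma> permutes X. \<Sum>z\<in>Z. \<phi> z)"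
  proof (rule sum.cong[OF refl])
    fix \<sigma> assume "\<sigma> \<in> {\<sigma>. \<sigma> permutes X}"
    then have \<sigma>: "\<sigma> permutes X" by simp
    have "act \<sigma> ` Z = Z"
      by (rule endo_inj_surj[OF finZ _ inj[OF \<sigma>]]) (use maps[OF \<sigma>] in auto)
    then have "bij_betw (act \<sigma>) Z Z" using inj[OF \<sigma>] by (simp add: bij_betw_def)
    then show "(\<Sum>z\<in>Z. \<phi> (act \<sigma> z)) = (\<Sum>z\<in>Z. \<phi> z)" by (rule sum.reindex_bij_betw)
  qed
  also have "\<dots> = fact (card X) * (\<Sum>z\<in>Z. \<phi> z)"
    using card_permutations[OF refl finX] by simp
  finally show ?thesis .
qed

context slice
begin

lemma sum_permutations_image:
  assumes x: "x \<in> Sl"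
  shows "real (card Sl) * (\<Sum>\<sigma> | \<sigma> permutes X. \<phi> (\<sigma> ` x)) = fact (card X) * (\<Sum>y\<in>Sl. \<phi> y)"
proof (rule sum_permutations_transitive[OF finX finite_Sl x, of image])
  show "\<sigma> ` z \<in> Sl" if "\<sigma> permutes X" "z \<in> Sl" for \<sigma> z
  proof -
    have "inj_on \<sigma> z" using permutes_inj[OF that(1)] inj_on_subset by blast
    then show ?thesis using that permutes_image[OF that(1)] by (auto simp: nsets_def card_image)
  qed
  show "inj_on ((`) \<sigma>) Sl" if "\<sigma> permutes X" for \<sigma>
    using inj_image_eq_iff[OF permutes_inj[OF that]] by (auto simp: inj_on_def)
  show "(\<sigma> \<circ> \<pi>) ` z = \<sigma> ` \<pi> ` z" for \<sigma> \<pi> :: "'a \<Rightarrow> 'a" and z by (simp add: image_comp)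
  fix y assume y: "y \<in> Sl"
  have "finite x" "finite y" "card x = card y" using x y by (auto simp: nsets_def)
  then obtain c where c: "bij_betw c x y" using finite_same_card_bij by blast
  obtain \<pi> where \<pi>: "\<pi> permutes X" "\<And>i. i \<in> x \<Longrightarrow> \<pi> i = c i"
    by (rule permutation_extending_injection[OF finX, of x c])
       (use c x y in \<open>auto simp: bij_betw_def nsets_def\<close>)
  then have "\<pi> ` x = y" using c by (auto simp: bij_betw_def)
  then show "\<exists>\<pi>. \<pi> permutes X \<and> \<pi> ` x = y" using \<pi>(1) by blast
qed

lemma sum_permutations_pair:
  assumes ij: "i\<^sub>0 \<in> X" "j\<^sub>0 \<in> X" "i\<^sub>0 \<noteq> j\<^sub>0"
  shows "N * (N - 1) * (\<Sum>\<sigma> | \<sigma> permutes X. \<psi> (\<sigma> i\<^sub>0) (\<sigma> j\<^sub>0)) =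
    fact (card X) * (\<Sum>i\<in>X. \<Sum>j\<in>X - {i}. \<psi> i j)"
proof -
  define Z where "Z = (SIGMA i:X. X - {i})"
  define act where "act = (\<lambda>\<sigma>::'a \<Rightarrow> 'a. map_prod \<sigma> \<sigma>)"
  have "real (card Z) * (\<Sum>\<sigma> | \<sigma> permutes X. (\<lambda>(i, j). \<psi> i j) (act \<sigma> (i\<^sub>0, j\<^sub>0))) =
    fact (card X) * (\<Sum>z\<in>Z. (\<lambda>(i, j). \<psi> i j) z)"
  proof (rule sum_permutations_transitive[OF finX, of Z])
    show "finite Z" using finX by (auto simp: Z_def)
    show "(i\<^sub>0, j\<^sub>0) \<in> Z" using ij by (simp add: Z_def)
    show "act \<sigma> z \<in> Z" if "\<sigma> permutes X" "z \<in> Z" for \<sigma> z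
      using that permutes_in_image[OF that(1)] permutes_inj[OF that(1)]
      by (auto simp: Z_def act_def inj_eq)
    show "inj_on (act \<sigma>) Z" if "\<sigma> permutes X" for \<sigma>
      using permutes_inj[OF that] by (auto simp: inj_on_def act_def)
    show "act (\<sigma> \<circ> \<pi>) z = act \<sigma> (act \<pi> z)" for \<sigma> \<pi> z
      by (cases z) (simp add: act_def)
    fix z assume "z \<in> Z"
    then obtain i j where z: "z = (i, j)" "i \<in> X" "j \<in> X" "i \<noteq> j" by (auto simp: Z_def)
    obtain \<pi> where \<pi>: "\<pi> permutes X" "\<And>t. t \<in> {i\<^sub>0, j\<^sub>0} \<Longrightarrow> \<pi> t = (if t = i\<^sub>0 then i else j)"
      by (rule permutation_extending_injection[OF finX, of "{i\<^sub>0, j\<^sub>0}" "\<lambda>t. if t = i\<^sub>0 then i else j"])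
         (use ij z in \<open>auto simp: inj_on_def\<close>)
    then show "\<exists>\<pi>. \<pi> permutes X \<and> act \<pi> (i\<^sub>0, j\<^sub>0) = z" using z ij by (auto simp: act_def)
  qed
  moreover have "real (card Z) = N * (N - 1)"
  proof -
    have "card Z = (\<Sum>i\<in>X. card (X - {i}))" unfolding Z_def using finX by (intro card_SigmaI) auto
    also have "\<dots> = card X * (card X - 1)" using finX by simp
    finally show ?thesis using kn by (simp add: N_def of_nat_diff)
  qed
  moreover have "(\<Sum>z\<in>Z. (\<lambda>(i, j). \<psi> i j) z) = (\<Sum>i\<in>X. \<Sum>j\<in>X - {i}. \<psi> i j)"
    unfolding Z_def using finX by (subst sum.Sigma) auto
  ultimately show ?thesis by (simp add: act_def)
qed

section \<open>Random cubes inside the slice\<close>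

definition cube_point :: "(nat \<Rightarrow> 'a) \<Rightarrow> (nat \<Rightarrow> 'a) \<Rightarrow> nat set \<Rightarrow> 'a set" where
  "cube_point u v A = u ` A \<union> v ` ({..<k} - A)"

lemma cube_point_in_Sl:
  assumes u: "inj_on u {..<k}" "u ` {..<k} \<subseteq> X" and v: "inj_on v {..<k}" "v ` {..<k} \<subseteq> X"
    and uv: "u ` {..<k} \<inter> v ` {..<k} = {}" and A: "A \<subseteq> {..<k}"
  shows "cube_point u v A \<in> Sl"
    and "lin a (cube_point u v A) = (\<Sum>t<k. if t \<in> A then a (u t) else a (v t))"
proof -
  have fA: "finite A" using A finite_subset by blast
  have inj: "inj_on u A" "inj_on v ({..<k} - A)"
    by (rule inj_on_subset[OF u(1) A], rule inj_on_subset[OF v(1)]) auto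
  have disj: "u ` A \<inter> v ` ({..<k} - A) = {}" using uv A by blast
  have "card (cube_point u v A) = card A + card ({..<k} - A)"
    unfolding cube_point_def using fA inj disj by (simp add: card_Un_disjoint card_image)
  also have "\<dots> = k" using A fA card_mono[of "{..<k}" A] by (simp add: card_Diff_subset)
  finally have "card (cube_point u v A) = k" .
  then show "cube_point u v A \<in> Sl"
    using A u v fA unfolding nsets_def cube_point_def by blast
  have "lin a (cube_point u v A) = (\<Sum>t\<in>A. a (u t)) + (\<Sum>t\<in>{..<k} - A. a (v t))"
    unfolding lin_def cube_point_def using fA inj disj
    by (simp add: sum.union_disjoint sum.reindex)
  also have "\<dots> = (\<Sum>t\<in>A. if t \<in> A then a (u t) else a (v t)) + (\<Sum>t\<in>{..<k} - A. if t \<in> A then a (u t) else a (v t))"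
    by simp
  also have "\<dots> = (\<Sum>t<k. if t \<in> A then a (u t) else a (v t))"
    using A by (metis (no_types, lifting) add.commute finite_lessThan sum.subset_diff)
  finally show "lin a (cube_point u v A) = (\<Sum>t<k. if t \<in> A then a (u t) else a (v t))" .
qed

text \<open>As \<open>f\<close> is Boolean, \<open>\<bar>2 * g - 1\<bar>\<close> is within
  \<open>2 * \<bar>f - g\<bar>\<close> of one for \<open>g = lin a\<close>, and on the cube
  \<open>2 * g - 1\<close> is a signed sum to which \<open>rad_near_dictator\<close> applies. The
  factor is 80 = 20 * 4.\<close>

lemma cube_defect_bound:
  assumes u: "inj_on u {..<k}" "u ` {..<k} \<subseteq> X" and v: "inj_on v {..<k}" "v ` {..<k} \<subseteq> X"
    and uv: "u ` {..<k} \<inter> v ` {..<k} = {}"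
    and f: "\<And>x. x \<in> Sl \<Longrightarrow> f x \<in> {0, 1 :: real}"
  shows "2 ^ k * (\<Sum>t<k. int_defect (a (u t) - a (v t))) \<le>
    80 * (\<Sum>A\<in>Pow {..<k}. (f (cube_point u v A) - lin a (cube_point u v A))\<^sup>2)"
proof -
  have sq: "(2 * z)\<^sup>2 = 4 * z\<^sup>2" for z :: real by (simp add: power_mult_distrib)
  define c where "c = (\<Sum>t<k. a (u t) + a (v t)) - 1"
  \<comment> \<open>the extra coordinate \<open>k\<close> carries the constant term\<close>
  define d where "d t = (if t = k then c else a (u t) - a (v t))" for t
  define S where "S = (\<Sum>A\<in>Pow {..<k}. (f (cube_point u v A) - lin a (cube_point u v A))\<^sup>2)"
  define \<eta> where "\<eta> = 4 * S / 2 ^ k"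
  have lin: "2 * lin a (cube_point u v A) - 1 = rad d {..<k} A + c" if A: "A \<subseteq> {..<k}" for A
  proof -
    have "2 * lin a (cube_point u v A) = (\<Sum>t<k. 2 * (if t \<in> A then a (u t) else a (v t)))"
      unfolding cube_point_in_Sl(2)[OF u v uv A] sum_distrib_left ..
    also have "\<dots> = (\<Sum>t<k. (if t \<in> A then d t else - d t) + (a (u t) + a (v t)))"
      by (intro sum.cong refl) (auto simp: d_def)
    finally show ?thesis by (simp add: rad_def c_def sum.distrib)
  qed
  have plus: "(\<Sum>A\<in>Pow {..<k}. (\<bar>rad d {..<k} A + c\<bar> - 1)\<^sup>2) \<le> 4 * S"
    unfolding S_def sum_distrib_left
  proof (rule sum_mono)
    fix A assume "A \<in> Pow {..<k}"
    then have A: "A \<subseteq> {..<k}" by simp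
    define g where "g = lin a (cube_point u v A)"
    have 1: "\<bar>rad d {..<k} A + c\<bar> = \<bar>2 * g - 1\<bar>" using lin[OF A] by (simp add: g_def)
    have "f (cube_point u v A) \<in> {0, 1}" using f cube_point_in_Sl(1)[OF u v uv A] by blast
    then have "\<bar>\<bar>2 * g - 1\<bar> - 1\<bar> \<le> \<bar>2 * (f (cube_point u v A) - g)\<bar>" by auto
    then have "\<bar>\<bar>2 * g - 1\<bar> - 1\<bar>\<^sup>2 \<le> \<bar>2 * (f (cube_point u v A) - g)\<bar>\<^sup>2" by (rule power_mono) simp
    then show "(\<bar>rad d {..<k} A + c\<bar> - 1)\<^sup>2 \<le> 4 * (f (cube_point u v A) - lin a (cube_point u v A))\<^sup>2"
      unfolding 1 g_def[symmetric] by (simp only: sq power2_abs)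
  qed
  \<comment> \<open>Complementing \<open>A\<close> negates the signed sum, so the half of the
    enlarged cube where \<open>c\<close> has sign minus deviates as much as the half where it has
    sign plus.\<close>
  have minus: "(\<Sum>A\<in>Pow {..<k}. (\<bar>rad d {..<k} A - c\<bar> - 1)\<^sup>2) = (\<Sum>A\<in>Pow {..<k}. (\<bar>rad d {..<k} A + c\<bar> - 1)\<^sup>2)"
  proof (rule sum.reindex_bij_witness[of _ "\<lambda>A. {..<k} - A" "\<lambda>A. {..<k} - A"], goal_cases)
    case (5 A)
    then have "rad d {..<k} ({..<k} - A) = - rad d {..<k} A" by (intro rad_complement) auto
    then have "\<bar>rad d {..<k} ({..<k} - A) + c\<bar> = \<bar>rad d {..<k} A - c\<bar>" by linarith
    then show ?case by simp
  qed auto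
  have "(\<Sum>A\<in>Pow (insert k {..<k}). (\<bar>rad d (insert k {..<k}) A\<bar> - 1)\<^sup>2) =
      (\<Sum>A\<in>Pow {..<k}. (\<bar>rad d {..<k} A - c\<bar> - 1)\<^sup>2 + (\<bar>rad d {..<k} A + c\<bar> - 1)\<^sup>2)"
    by (subst sum_Pow_insert) (auto intro!: sum.cong simp: rad_insert d_def)
  also have "\<dots> \<le> 2 * (4 * S)" using plus minus by (simp add: sum.distrib)
  also have "\<dots> = 2 ^ card (insert k {..<k}) * \<eta>" by (simp add: \<eta>_def)
  finally have "(\<Sum>t\<in>insert k {..<k}. int_defect (d t)) \<le> 20 * \<eta>"
    by (intro rad_near_dictator) auto
  moreover have "(\<Sum>t<k. int_defect (a (u t) - a (v t))) \<le> (\<Sum>t\<in>insert k {..<k}. int_defect (d t))"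
    using int_defect_nonneg[of c] by (simp add: d_def)
  ultimately have "(\<Sum>t<k. int_defect (a (u t) - a (v t))) \<le> 80 * S / 2 ^ k" by (simp add: \<eta>_def)
  then show ?thesis by (simp add: S_def field_simps)
qed

text \<open>A fixed cube is moved by a random permutation: each vertex becomes uniform on the slice
  and each \<open>(u t, v t)\<close> a uniform ordered pair of distinct points. The \<open>k\<close>
  pairs contribute a factor \<open>K\<close>, which \<open>card_Sl\<close> turns into
  \<open>N * M\<close>, so nothing depending on \<open>k/n\<close> is lost.\<close>

lemma sum_pair_defect:
  assumes f: "\<And>x. x \<in> Sl \<Longrightarrow> f x \<in> {0, 1 :: real}"
  shows "M * (\<Sum>i\<in>X. \<Sum>j\<in>X - {i}. int_defect (a i - a j)) \<le> 80 * (N - 1) * (\<Sum>x\<in>Sl. (f x - lin a x)\<^sup>2)"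
proof -
  define q where "q x = (f x - lin a x)\<^sup>2" for x
  define Q where "Q = (\<Sum>x\<in>Sl. q x)"
  define R where "R = (\<Sum>i\<in>X. \<Sum>j\<in>X - {i}. int_defect (a i - a j))"
  define c where "c = real (card Sl)"
  obtain h where h: "bij_betw h {0..<card X} X" using ex_bij_betw_nat_finite[OF finX] by blast
  define u where "u t = h t" for t
  define v where "v t = h (k + t)" for t
  have hi: "inj_on h {0..<card X}" "h ` {0..<card X} = X" using h by (auto simp: bij_betw_def)
  have hmem: "h t \<in> X" if "t < card X" for t using hi that by auto
  have heq: "h s = h t \<longleftrightarrow> s = t" if "s < card X" "t < card X" for s t
    using hi that by (auto simp: inj_on_def)
  have u: "inj_on u {..<k}" "u ` {..<k} \<subseteq> X" and v: "inj_on v {..<k}" "v ` {..<k} \<subseteq> X"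
    and uv: "u ` {..<k} \<inter> v ` {..<k} = {}"
    using kn by (auto simp: u_def v_def inj_on_def heq intro!: hmem)
  have cpos: "c > 0"
  proof -
    have "K * c > 0" unfolding c_def card_Sl using N_gt K_ge_1 M_pos by simp
    then show ?thesis using K_ge_1 by (simp add: zero_less_mult_iff)
  qed
  have pt: "2 ^ k * (\<Sum>t<k. int_defect (a (\<sigma> (u t)) - a (\<sigma> (v t)))) \<le>
      80 * (\<Sum>A\<in>Pow {..<k}. q (\<sigma> ` cube_point u v A))" if \<sigma>: "\<sigma> permutes X" for \<sigma>
  proof -
    have inj: "inj \<sigma>" and im: "\<sigma> ` X = X" using permutes_inj[OF \<sigma>] permutes_image[OF \<sigma>] by auto
    have "\<sigma> ` cube_point u v A = cube_point (\<sigma> \<circ> u) (\<sigma> \<circ> v) A" for A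
      by (simp add: cube_point_def image_Un image_comp)
    moreover have "2 ^ k * (\<Sum>t<k. int_defect (a ((\<sigma> \<circ> u) t) - a ((\<sigma> \<circ> v) t))) \<le>
      80 * (\<Sum>A\<in>Pow {..<k}. (f (cube_point (\<sigma> \<circ> u) (\<sigma> \<circ> v) A) - lin a (cube_point (\<sigma> \<circ> u) (\<sigma> \<circ> v) A))\<^sup>2)"
    proof (rule cube_defect_bound[OF _ _ _ _ _ f])
      show "inj_on (\<sigma> \<circ> u) {..<k}" "inj_on (\<sigma> \<circ> v) {..<k}"
        using u v inj inj_on_subset by (blast intro: comp_inj_on)+
      show "(\<sigma> \<circ> u) ` {..<k} \<subseteq> X" "(\<sigma> \<circ> v) ` {..<k} \<subseteq> X"
        using u v im by (auto simp: image_comp[symmetric])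
      show "(\<sigma> \<circ> u) ` {..<k} \<inter> (\<sigma> \<circ> v) ` {..<k} = {}"
        unfolding image_comp[symmetric] image_Int[OF inj, symmetric] uv by simp
    qed
    ultimately show ?thesis by (simp add: q_def)
  qed
  have "2 ^ k * (\<Sum>\<sigma> | \<sigma> permutes X. \<Sum>t<k. int_defect (a (\<sigma> (u t)) - a (\<sigma> (v t))))
     \<le> 80 * (\<Sum>\<sigma> | \<sigma> permutes X. \<Sum>A\<in>Pow {..<k}. q (\<sigma> ` cube_point u v A))"
    unfolding sum_distrib_left[of _ "\<lambda>\<sigma>. \<Sum>t<k. _ \<sigma> t"] sum_distrib_left[of _ "\<lambda>\<sigma>. \<Sum>A\<in>_. _ \<sigma> A"]
    by (rule sum_mono) (use pt in auto)
  also have "(\<Sum>\<sigma> | \<sigma> permutes X. \<Sum>A\<in>Pow {..<k}. q (\<sigma> ` cube_point u v A)) =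
      (\<Sum>A\<in>Pow {..<k}. \<Sum>\<sigma> | \<sigma> permutes X. q (\<sigma> ` cube_point u v A))" by (rule sum.swap)
  also have "\<dots> = (\<Sum>A\<in>Pow {..<k}. fact (card X) * Q / c)"
  proof (rule sum.cong[OF refl])
    fix A assume "A \<in> Pow {..<k}"
    then have "cube_point u v A \<in> Sl" using cube_point_in_Sl(1)[OF u v uv] by auto
    from sum_permutations_image[OF this, of q]
    show "(\<Sum>\<sigma> | \<sigma> permutes X. q (\<sigma> ` cube_point u v A)) = fact (card X) * Q / c"
      using cpos by (simp add: Q_def c_def field_simps)
  qed
  also have "\<dots> = 2 ^ k * (fact (card X) * Q / c)" by (simp add: card_Pow)
  also have "(\<Sum>\<sigma> | \<sigma> permutes X. \<Sum>t<k. int_defect (a (\<sigma> (u t)) - a (\<sigma> (v t)))) =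
      (\<Sum>t<k. \<Sum>\<sigma> | \<sigma> permutes X. int_defect (a (\<sigma> (u t)) - a (\<sigma> (v t))))" by (rule sum.swap)
  also have "\<dots> = (\<Sum>t<k. fact (card X) * R / (N * (N - 1)))"
  proof (rule sum.cong[OF refl])
    fix t assume t: "t \<in> {..<k}"
    have "u t \<in> X" "v t \<in> X" "u t \<noteq> v t" using t u v uv by auto
    from sum_permutations_pair[OF this, of "\<lambda>i j. int_defect (a i - a j)"]
    show "(\<Sum>\<sigma> | \<sigma> permutes X. int_defect (a (\<sigma> (u t)) - a (\<sigma> (v t)))) = fact (card X) * R / (N * (N - 1))"
      using N_gt K_ge_1 by (simp add: R_def eq_divide_eq mult_ac)
  qed
  also have "\<dots> = K * (fact (card X) * R / (N * (N - 1)))" by (simp add: K_def)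
  finally have "2 ^ k * (fact (card X) * (K * R / (N * (N - 1)))) \<le> 2 ^ k * (fact (card X) * (80 * Q / c))"
    by (simp add: mult_ac)
  then have "(2 ^ k * fact (card X)) * (K * R / (N * (N - 1))) \<le> (2 ^ k * fact (card X)) * (80 * Q / c)"
    by (simp only: mult.assoc)
  then have main: "K * R / (N * (N - 1)) \<le> 80 * Q / c" by (rule mult_left_le_imp_le) simp
  have NN: "N * (N - 1) > 0" using N_gt K_ge_1 by simp
  have "K * R * c \<le> 80 * Q * (N * (N - 1))"
    using main NN cpos by (simp add: field_simps)
  then have "R * (N * M) \<le> 80 * Q * (N * (N - 1))"
    unfolding card_Sl[symmetric] c_def by (simp add: mult_ac)
  then have "N * (M * R) \<le> N * (80 * (N - 1) * Q)" by (simp add: mult_ac)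
  then have "M * R \<le> 80 * (N - 1) * Q" using N_gt K_ge_1 by simp
  then show ?thesis by (simp add: R_def Q_def q_def)
qed

text \<open>Some \<open>j\<close> is no worse than the average. Subtracting \<open>a j\<close> from
  all coefficients changes \<open>lin a\<close> on the slice only by the constant
  \<open>K * a j\<close>.\<close>

lemma reference_element:
  assumes f: "\<And>x. x \<in> Sl \<Longrightarrow> f x \<in> {0, 1 :: real}"
    and dist: "(\<Sum>x\<in>Sl. (f x - lin a x)\<^sup>2) \<le> \<delta> * M"
  obtains j where "j \<in> X" "(\<Sum>i\<in>X. int_defect (a i - a j)) \<le> 80 * \<delta>"
proof -
  have "0 \<le> \<delta> * M" using dist by (meson order_trans sum_nonneg zero_le_power2)
  then have \<delta>: "\<delta> \<ge> 0" using M_pos by (simp add: zero_le_mult_iff)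
  have "M * (\<Sum>i\<in>X. \<Sum>j\<in>X - {i}. int_defect (a i - a j)) \<le> 80 * (N - 1) * (\<delta> * M)"
    by (rule order_trans[OF sum_pair_defect[OF f]]) (use dist N_gt K_ge_1 in \<open>auto intro!: mult_left_mono\<close>)
  also have "\<dots> \<le> M * (N * (80 * \<delta>))" using \<delta> M_pos by (simp add: algebra_simps)
  finally have le: "(\<Sum>i\<in>X. \<Sum>j\<in>X - {i}. int_defect (a i - a j)) \<le> N * (80 * \<delta>)" using M_pos by simp
  have full: "(\<Sum>j\<in>X - {i}. int_defect (a i - a j)) = (\<Sum>j\<in>X. int_defect (a j - a i))" if "i \<in> X" for i
  proof -
    have "(\<Sum>j\<in>X. int_defect (a j - a i)) = int_defect (a i - a i) + (\<Sum>j\<in>X - {i}. int_defect (a j - a i))"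
      by (rule sum.remove[OF finX that])
    also have "int_defect (a i - a i) = 0" by (simp add: int_defect_def)
    finally show ?thesis using int_defect_minus[of "a i - a j" for j] by (simp add: minus_diff_eq)
  qed
  have "\<exists>j\<in>X. (\<Sum>i\<in>X. int_defect (a i - a j)) \<le> 80 * \<delta>"
  proof (rule ccontr)
    assume "\<not> ?thesis"
    then have "(\<Sum>j\<in>X. 80 * \<delta>) < (\<Sum>j\<in>X. \<Sum>i\<in>X. int_defect (a i - a j))"
      using finX kn by (intro sum_strict_mono) auto
    then show False using le full by (simp add: N_def)
  qed
  then show thesis using that by blast
qed

text \<open>The number subtracted on the left is the mean of \<open>lin a\<close>. For centred
  coefficients the total in \<open>sum_star_lin\<close> vanishes, so star sums are a fixed multiple
  of the coefficients.\<close>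

lemma lin_variance:
  "(\<Sum>x\<in>Sl. (lin a x - K * ((\<Sum>i\<in>X. a i) / N))\<^sup>2) =
    M * (N - K) / (N - 1) * ((\<Sum>i\<in>X. (a i)\<^sup>2) - (\<Sum>i\<in>X. a i)\<^sup>2 / N)"
proof -
  define s where "s = (\<Sum>i\<in>X. a i)"
  define b where "b i = a i - s / N" for i
  have N0: "N > 0" using N_gt K_ge_1 by simp
  have sb: "(\<Sum>i\<in>X. b i) = 0" using N0 by (simp add: b_def sum_subtractf s_def[symmetric] N_def[symmetric])
  have lb: "lin b x = lin a x - K * (s / N)" if "x \<in> Sl" for x
    using that by (simp add: lin_def b_def sum_subtractf nsets_def K_def)
  have "(\<Sum>x\<in>Sl. (lin a x - K * (s / N))\<^sup>2) = (\<Sum>x\<in>Sl. lin b x * lin b x)"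
    by (intro sum.cong refl) (simp add: lb power2_eq_square)
  also have "\<dots> = (\<Sum>i\<in>X. b i * (M * (N - K) / (N - 1) * b i))"
    unfolding sum_mult_lin by (intro sum.cong refl) (simp add: sum_star_lin sb)
  also have "\<dots> = M * (N - K) / (N - 1) * (\<Sum>i\<in>X. (b i)\<^sup>2)"
    unfolding sum_distrib_left by (intro sum.cong refl) (simp add: power2_eq_square)
  also have "(\<Sum>i\<in>X. (b i)\<^sup>2) = (\<Sum>i\<in>X. (a i)\<^sup>2 - 2 * (s / N) * a i + (s / N)\<^sup>2)"
    by (intro sum.cong refl) (simp add: b_def power2_diff algebra_simps)
  also have "\<dots> = (\<Sum>i\<in>X. (a i)\<^sup>2) - 2 * (s / N) * s + N * (s / N)\<^sup>2"
    unfolding sum.distrib sum_subtractf sum_distrib_left[symmetric] s_def[symmetric] by (simp add: N_def)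
  also have "\<dots> = (\<Sum>i\<in>X. (a i)\<^sup>2) - s\<^sup>2 / N"
    using N0 by (simp add: power2_eq_square field_simps)
  finally show ?thesis by (simp add: s_def)
qed

text \<open>Rounding leaves an error \<open>e\<close> small in l2, so \<open>lin e\<close> has small
  variance but possibly a large mean, which is moved into the constant. This gives 2 + 2 * 80 = 162
  with a real constant; rounding the constant costs a factor 4.\<close>

lemma integer_approximation:
  assumes f: "\<And>x. x \<in> Sl \<Longrightarrow> f x \<in> {0, 1 :: real}"
    and dist: "(\<Sum>x\<in>Sl. (f x - lin a x)\<^sup>2) \<le> \<delta> * M"
  obtains c :: int and s :: "'a \<Rightarrow> int" where
    "(\<Sum>x\<in>Sl. (f x - (of_int c + lin (\<lambda>i. of_int (s i)) x))\<^sup>2) \<le> 648 * \<delta> * M"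
proof -
  obtain j where j: "j \<in> X" "(\<Sum>i\<in>X. int_defect (a i - a j)) \<le> 80 * \<delta>"
    by (rule reference_element[OF f dist])
  have "\<exists>s::int. (y - of_int s)\<^sup>2 = int_defect y" for y
  proof (cases "y\<^sup>2 \<le> (\<bar>y\<bar> - 1)\<^sup>2")
    case True
    then show ?thesis by (intro exI[of _ 0]) (simp add: int_defect_def min_def)
  next
    case False
    have "(\<bar>y\<bar> - 1)\<^sup>2 = (y - of_int (if y \<ge> 0 then 1 else - 1))\<^sup>2"
      by (simp add: power2_eq_square algebra_simps)
    then show ?thesis using False by (intro exI[of _ "if y \<ge> 0 then 1 else - 1"]) (simp add: int_defect_def min_def)
  qed
  then obtain r :: "real \<Rightarrow> int" where r: "\<And>y. (y - of_int (r y))\<^sup>2 = int_defect y" by metis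
  define s where "s i = r (a i - a j)" for i
  define e where "e i = a i - a j - of_int (s i)" for i
  define h where "h x = lin (\<lambda>i. of_int (s i)) x" for x
  have e2: "(\<Sum>i\<in>X. (e i)\<^sup>2) \<le> 80 * \<delta>" using j(2) by (simp add: e_def s_def r)
  have pos: "N > 0" "N - 1 > 0" "N - K > 0" using N_gt K_ge_1 by auto
  define m where "m = K * ((\<Sum>i\<in>X. e i) / N)"
  define c where "c = K * a j + m"
  have le: "lin e x = lin a x - K * a j - h x" if "x \<in> Sl" for x
    using that by (simp add: lin_def e_def h_def sum_subtractf nsets_def K_def)
  have "(\<Sum>x\<in>Sl. (lin e x - m)\<^sup>2) = M * ((N - K) / (N - 1)) * ((\<Sum>i\<in>X. (e i)\<^sup>2) - (\<Sum>i\<in>X. e i)\<^sup>2 / N)"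
    unfolding m_def lin_variance by simp
  also have "\<dots> \<le> M * ((N - K) / (N - 1)) * (80 * \<delta>)"
  proof (rule mult_left_mono)
    have "(\<Sum>i\<in>X. e i)\<^sup>2 / N \<ge> 0" using pos by simp
    then show "(\<Sum>i\<in>X. (e i)\<^sup>2) - (\<Sum>i\<in>X. e i)\<^sup>2 / N \<le> 80 * \<delta>" using e2 by linarith
  qed (use pos M_pos in auto)
  also have "\<dots> \<le> M * 1 * (80 * \<delta>)"
    using pos M_pos K_ge_1 e2 by (intro mult_right_mono mult_left_mono order_trans[OF sum_nonneg e2]) (auto simp: field_simps)
  finally have var: "(\<Sum>x\<in>Sl. (lin e x - m)\<^sup>2) \<le> 80 * \<delta> * M" by (simp add: mult_ac)
  have "(\<Sum>x\<in>Sl. (f x - h x - c)\<^sup>2) \<le> (\<Sum>x\<in>Sl. 2 * (f x - lin a x)\<^sup>2 + 2 * (lin e x - m)\<^sup>2)"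
  proof (rule sum_mono)
    fix x assume "x \<in> Sl"
    then have "f x - h x - c = (f x - lin a x) + (lin e x - m)" by (simp add: le c_def)
    then show "(f x - h x - c)\<^sup>2 \<le> 2 * (f x - lin a x)\<^sup>2 + 2 * (lin e x - m)\<^sup>2"
      using square_sum_le by metis
  qed
  also have "\<dots> \<le> 162 * \<delta> * M" using var dist by (simp add: sum.distrib sum_distrib_left[symmetric])
  finally have real_c: "(\<Sum>x\<in>Sl. (f x - h x - c)\<^sup>2) \<le> 162 * \<delta> * M" .
  define c0 where "c0 = round c"
  have c0: "\<bar>of_int c0 - c\<bar> \<le> 1 / 2" unfolding c0_def by (rule of_int_round_abs_le)
  have "(\<Sum>x\<in>Sl. (f x - (of_int c0 + h x))\<^sup>2) \<le> (\<Sum>x\<in>Sl. 4 * (f x - h x - c)\<^sup>2)"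
  proof (rule sum_mono)
    fix x assume x: "x \<in> Sl"
    have "\<exists>w::int. f x - h x = of_int w"
    proof -
      have "h x = of_int (\<Sum>i\<in>x. s i)" by (simp add: h_def lin_def)
      moreover have "f x = of_int (if f x = 0 then 0 else 1)" using f[OF x] by auto
      ultimately show ?thesis by (metis of_int_diff)
    qed
    then obtain w :: int where w: "f x - h x = of_int w" by blast
    \<comment> \<open>\<open>c0\<close> is an integer nearest to \<open>c\<close>, so
      \<open>w - c0\<close> is zero or has modulus at least 1, and replacing \<open>c\<close> by
      \<open>c0\<close> at most doubles the distance to the integer \<open>w\<close>.\<close>
    have "\<bar>real_of_int w - of_int c0\<bar> \<le> \<bar>2 * (of_int w - c)\<bar>"
    proof (cases "w = c0")
      case False
      then have "\<bar>w - c0\<bar> \<ge> 1" by linarith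
      then have "\<bar>real_of_int w - of_int c0\<bar> \<ge> 1" by (metis of_int_1_le_iff of_int_abs of_int_diff)
      moreover have "\<bar>real_of_int w - of_int c0\<bar> \<le> \<bar>of_int w - c\<bar> + 1 / 2" using c0 by linarith
      moreover have "y \<le> 2 * z" if "1 \<le> y" "y \<le> z + 1 / 2" for y z :: real using that by linarith
      ultimately show ?thesis unfolding abs_mult abs_numeral by blast
    qed simp
    then have "\<bar>real_of_int w - of_int c0\<bar>\<^sup>2 \<le> \<bar>2 * (of_int w - c)\<bar>\<^sup>2" by (rule power_mono) simp
    moreover have "f x - (of_int c0 + h x) = of_int w - of_int c0" using w by simp
    moreover have "\<bar>2 * (of_int w - c)\<bar>\<^sup>2 = 4 * (of_int w - c)\<^sup>2"
      by (simp only: power2_abs power_mult_distrib) simp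
    ultimately show "(f x - (of_int c0 + h x))\<^sup>2 \<le> 4 * (f x - h x - c)\<^sup>2"
      by (simp only: w power2_abs)
  qed
  also have "\<dots> \<le> 648 * \<delta> * M" using real_c by (simp add: sum_distrib_left[symmetric])
  finally show thesis using that[of c0 s] by (simp add: h_def)
qed

end

section \<open>Integral linear functions close to an indicator function\<close>

text \<open>Here \<open>B\<close> and \<open>B2\<close> are the sum and the sum of squares of the integral coefficients, and \<open>L k/n\<close> is
  the mean of the function. The second alternative is the complement of a star, whose size is almost
  that of a star when \<open>n\<close> is close to \<open>2k\<close>.\<close>

lemma coefficient_dichotomy:
  fixes n k l :: nat and c B B2 :: int and L \<tau> \<alpha> :: real
  assumes k: "k > 0" and l: "l > 0" and n: "n > 2 * k * l\<^sup>2"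
    and spread: "2 * B\<^sup>2 \<le> int n * B2" and B: "\<bar>B\<bar> \<le> B2"
    and L: "L * real k = of_int c * real n + of_int B * real k"
    and near: "\<bar>L - (real l - \<alpha>)\<bar> \<le> \<tau>" and small: "\<tau> \<le> 1 / 200" "\<bar>\<alpha>\<bar> \<le> 1 / 200"
    and var: "(real n - real k) / (real n - 1) * (of_int B2 - (of_int B)\<^sup>2 / real n)
      + real k / real n * L\<^sup>2 - L \<le> 2 * \<tau>"
  shows "(c = 0 \<and> B = int l \<and> B2 \<le> int l + 1) \<or> (l = 1 \<and> c = 1 \<and> B = - 1 \<and> B2 = 1)"
proof -
  define p where "p = real k / real n"
  define \<theta> where "\<theta> = L - real l"
  have \<theta>: "\<bar>\<theta>\<bar> \<le> 1 / 100" using near small unfolding \<theta>_def by linarith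
  have l1: "real l \<ge> 1" "real k \<ge> 1" using l k by auto
  have l2: "(real l)\<^sup>2 \<ge> real l" using l1 by (simp add: power2_eq_square)
  have nr: "real n > 2 * real k * (real l)\<^sup>2"
  proof -
    have "real n > real (2 * k * l\<^sup>2)" using n by (simp only: of_nat_less_iff)
    then show ?thesis by simp
  qed
  have "real k * 1 \<le> real k * (real l)\<^sup>2" using l1 l2 by (intro mult_left_mono) linarith+
  then have nk: "real n > 2 * real k" using nr by linarith
  have "1 * (real l)\<^sup>2 \<le> real k * (real l)\<^sup>2" using l1 by (intro mult_right_mono) auto
  then have nl': "real n > 2 * (real l)\<^sup>2" using nr by linarith
  have nl: "real n \<ge> 2 * (real l)\<^sup>2 + 1"
  proof -
    have "real n > real (2 * l\<^sup>2)" using nl' by simp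
    then have "n > 2 * l\<^sup>2" by (simp only: of_nat_less_iff)
    then have "n \<ge> 2 * l\<^sup>2 + 1" by simp
    then have "real n \<ge> real (2 * l\<^sup>2 + 1)" by (simp only: of_nat_le_iff)
    then show ?thesis by simp
  qed
  have n0: "real n > 1" using nk l1 by linarith
  then have nn: "real n * (real n - 1) > 0" by simp
  have p: "p > 0" "p * (real l)\<^sup>2 < 1 / 2" "p < 1 / 2" "p * real n = real k"
    using nr nk n0 l1 by (auto simp: p_def field_simps)
  have pl: "p * real l \<le> p * (real l)\<^sup>2" using p(1) l2 by (intro mult_left_mono) auto
  have small_cross: "\<bar>2 * p * real l * \<theta>\<bar> \<le> 1 / 100"
  proof -
    have "\<bar>2 * p * real l * \<theta>\<bar> = (2 * (p * real l)) * \<bar>\<theta>\<bar>" using p l1 by (simp add: abs_mult)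
    also have "\<dots> \<le> 1 * \<bar>\<theta>\<bar>" using pl p(2) by (intro mult_right_mono) linarith+
    finally show ?thesis using \<theta> by simp
  qed
  \<comment> \<open>The left side is at most \<open>l - p * l\<^sup>2 + 3/100\<close>, the three
    errors being those of \<open>\<theta>\<close>, the cross term and \<open>2 * \<tau>\<close>;
    moreover \<open>p * l \<le> p * l\<^sup>2\<close>, and \<open>(1 - p) / 10\<close> exceeds
    1/20.\<close>
  have e1: "L - p * L\<^sup>2 + 2 * \<tau> \<le> (1 - p) * (real l + 1 / 10)"
  proof -
    have "L = real l + \<theta>" by (simp add: \<theta>_def)
    then have "L - p * L\<^sup>2 = real l + \<theta> - p * (real l)\<^sup>2 - 2 * p * real l * \<theta> - p * \<theta>\<^sup>2"
      by (simp add: power2_eq_square algebra_simps)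
    moreover have "p * \<theta>\<^sup>2 \<ge> 0" using p by simp
    moreover have "(1 - p) * (real l + 1 / 10) = real l - p * real l + 1 / 10 - p / 10"
      by (simp add: field_simps)
    ultimately show ?thesis using \<theta> small small_cross pl p by linarith
  qed
  have e2: "1 - p = (real n - real k) / real n" using n0 by (simp add: p_def field_simps)
  have "(real n - real k) / (real n - 1) * (of_int B2 - (of_int B)\<^sup>2 / real n) \<le>
      (real n - real k) / real n * (real l + 1 / 10)"
    using var e1 unfolding p_def[symmetric] e2[symmetric] by linarith
  then have "(real n - real k) * ((of_int B2 - (of_int B)\<^sup>2 / real n) / (real n - 1)) \<le>
      (real n - real k) * ((real l + 1 / 10) / real n)" by simp
  then have "(of_int B2 - (of_int B)\<^sup>2 / real n) / (real n - 1) \<le> (real l + 1 / 10) / real n"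
    by (rule mult_left_le_imp_le) (use nk in simp)
  then have "real n * (of_int B2 - (of_int B)\<^sup>2 / real n) \<le> (real n - 1) * (real l + 1 / 10)"
    (is "_ * ?A \<le> _ * ?C")
    using n0 nn frac_le_eq[of "real n - 1" "real n" ?A ?C] by (auto simp: divide_le_0_iff mult.commute)
  then have I: "real n * of_int B2 - (of_int B)\<^sup>2 \<le> (real n - 1) * (real l + 1 / 10)"
    using n0 by (simp add: right_diff_distrib)
  have "real_of_int (2 * B\<^sup>2) \<le> real_of_int (int n * B2)" using spread by (simp only: of_int_le_iff)
  then have sp: "2 * (real_of_int B)\<^sup>2 \<le> real n * of_int B2" by simp
  \<comment> \<open>By \<open>spread\<close>, \<open>B\<^sup>2\<close> is at most half of
    \<open>n * B2\<close>, so the left side of \<open>I\<close> retains at least half of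
    \<open>n * B2\<close>. This bounds \<open>B2\<close> by \<open>2 * l\<close>.\<close>
  have II: "real n * of_int B2 \<le> (real n - 1) * (2 * real l + 1 / 5)" using I sp by (simp add: algebra_simps)
  also have "\<dots> < real n * (2 * real l + 1 / 5)" using n0 l1 by (intro mult_strict_right_mono) auto
  finally have "real_of_int B2 < 2 * real l + 1 / 5" using n0 by simp
  then have "real_of_int B2 < real_of_int (2 * int l + 1)" by simp
  then have "B2 < 2 * int l + 1" by (simp only: of_int_less_iff)
  then have x2: "B2 \<le> 2 * int l" by simp
  have "B\<^sup>2 \<le> B2\<^sup>2" using B by (metis abs_ge_zero power2_abs power_mono)
  then have "real_of_int (B\<^sup>2) \<le> real_of_int (B2\<^sup>2)" by (simp only: of_int_le_iff)
  then have BB: "(real_of_int B)\<^sup>2 \<le> (real_of_int B2)\<^sup>2" by simp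
  define x where "x = real_of_int B2"
  \<comment> \<open>With \<open>\<bar>B\<bar> \<le> B2\<close> the bound becomes quadratic in
    \<open>x\<close> and excludes a middle range; the upper range is already excluded by
    \<open>x2\<close>.\<close>
  have I': "x * (real n - x) \<le> (real n - 1) * (real l + 1 / 10)"
    using I BB by (simp add: x_def power2_eq_square algebra_simps)
  show ?thesis
  proof (cases "l = 1")
    case True
    \<comment> \<open>For \<open>B2 = 2\<close>, \<open>I'\<close> forces \<open>n < 4\<close>
      whereas \<open>II\<close> forces \<open>n \<ge> 11\<close>.\<close>
    have "B2 \<noteq> 2"
    proof
      assume "B2 = 2"
      then have "x = 2" by (simp add: x_def)
      then show False using I' II True by (simp add: x_def)
    qed
    then have B21: "B2 \<le> 1" using x2 True by simp
    have L1: "\<bar>L - 1\<bar> \<le> 1 / 100" using \<theta> True by (simp add: \<theta>_def)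
    have cn: "of_int c * real n = (L - of_int B) * real k" using L by (simp add: algebra_simps)
    \<comment> \<open>Because \<open>n > 2 * k\<close>. As \<open>L\<close> is near 1, a nonzero
      \<open>c\<close> needs \<open>\<bar>L - B\<bar> > 2\<close>, which only \<open>B = - 1\<close>
      allows: here the complement of a star survives.\<close>
    have cbig: "\<bar>L - of_int B\<bar> > 2 * \<bar>real_of_int c\<bar>" if "c \<noteq> 0"
    proof -
      have "2 * real k * \<bar>real_of_int c\<bar> < real n * \<bar>real_of_int c\<bar>" using nk that by (intro mult_strict_right_mono) auto
      also have "\<dots> = \<bar>of_int c * real n\<bar>" by (simp add: abs_mult)
      also have "\<dots> = \<bar>L - of_int B\<bar> * real k" unfolding cn by (simp add: abs_mult)
      finally have "real k * (2 * \<bar>real_of_int c\<bar>) < real k * \<bar>L - of_int B\<bar>" by (simp add: mult_ac)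
      then show ?thesis using k by simp
    qed
    have cge: "\<bar>real_of_int c\<bar> \<ge> 1" if "c \<noteq> 0" using that by linarith
    consider "B = 1" | "B = 0" | "B = - 1" using B B21 by linarith
    then show ?thesis
    proof cases
      case 1
      have "c = 0"
      proof (rule ccontr)
        assume "c \<noteq> 0"
        then show False using cbig cge L1 1 by force
      qed
      then show ?thesis using 1 True B21 by simp
    next
      case 2
      have "c = 0"
      proof (rule ccontr)
        assume "c \<noteq> 0"
        then show False using cbig cge L1 2 by force
      qed
      then have "L = 0" using cn 2 l1 by simp
      then show ?thesis using L1 by simp
    next
      case 3
      have c0: "c \<noteq> 0"
      proof
        assume "c = 0"
        then have "L = - 1" using cn 3 l1 by simp
        then show False using L1 by simp
      qed
      have LB: "L - of_int B = L + 1" using 3 by simp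
      have "\<bar>L + 1\<bar> < 4" "L + 1 > 0" using L1 by linarith+
      then have "2 * \<bar>real_of_int c\<bar> < 4" using cbig[OF c0] unfolding LB by (metis less_trans)
      then have "\<bar>real_of_int c\<bar> < 2" by simp
      then have "\<bar>c\<bar> < 2" by linarith
      moreover have "of_int c * real n > 0" unfolding cn LB using \<open>L + 1 > 0\<close> l1 by simp
      then have "c > 0" using n0 by (simp add: zero_less_mult_iff)
      ultimately have "c = 1" by linarith
      then show ?thesis using 3 True B B21 by simp
    qed
  next
    case False
    then have lge: "real l \<ge> 2" using l by linarith
    have ll: "(real l)\<^sup>2 \<ge> 2 * real l" using lge by (simp add: power2_eq_square)
    \<comment> \<open>For \<open>l + 2 \<le> x \<le> 2 * l\<close> the value of
      \<open>x * (n - x)\<close> is at least that at \<open>l + 2\<close>, since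
      \<open>x + l + 2 \<le> n\<close>. This yields \<open>19/10 * n \<le> (l + 2)\<^sup>2\<close>,
      which \<open>n \<ge> 2 * l\<^sup>2 + 1\<close> forbids for \<open>l \<ge> 2\<close>. The value
      \<open>B2 = l + 1\<close> is left to a parity argument.\<close>
    have B2l: "B2 \<le> int l + 1"
    proof (rule ccontr)
      assume "\<not> ?thesis"
      then have "B2 \<ge> int l + 2" by simp
      then have "real_of_int (int l + 2) \<le> real_of_int B2" by (simp only: of_int_le_iff)
      then have xl: "x \<ge> real l + 2" by (simp add: x_def)
      have "real_of_int B2 \<le> real_of_int (2 * int l)" using x2 by (simp only: of_int_le_iff)
      then have xu: "x \<le> 2 * real l" by (simp add: x_def)
      have "(x - (real l + 2)) * (real n - x - (real l + 2)) \<ge> 0"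
        using xl xu nl ll lge by (intro mult_nonneg_nonneg) linarith+
      then have "(real l + 2) * (real n - (real l + 2)) \<le> x * (real n - x)"
        by (simp add: algebra_simps)
      also have "\<dots> \<le> (real n - 1) * (real l + 1 / 10)" by (rule I')
      also have "\<dots> \<le> real n * (real l + 1 / 10)" using l1 by (intro mult_right_mono) auto
      finally have "19 / 10 * real n \<le> (real l + 2)\<^sup>2" by (simp add: power2_eq_square algebra_simps)
      also have "\<dots> = (real l)\<^sup>2 + 4 * real l + 4" by (simp add: power2_eq_square algebra_simps)
      finally show False using nl ll lge by linarith
    qed
    have c0: "c = 0"
    proof (rule ccontr)
      assume "c \<noteq> 0"
      then have "\<bar>real_of_int c\<bar> \<ge> 1" by linarith
      then have "real n \<le> \<bar>real_of_int c\<bar> * real n" using mult_right_mono[of 1 "\<bar>real_of_int c\<bar>" "real n"] by simp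
      also have "\<dots> = \<bar>of_int c * real n\<bar>" by (simp add: abs_mult)
      also have "of_int c * real n = (L - of_int B) * real k" using L by (simp add: algebra_simps)
      also have "\<bar>(L - of_int B) * real k\<bar> = \<bar>L - of_int B\<bar> * real k" by (simp add: abs_mult)
      also have "\<dots> \<le> (2 * real l + 2) * real k"
      proof (rule mult_right_mono)
        have "\<bar>B\<bar> \<le> int l + 1" using B B2l by simp
        then have "real_of_int \<bar>B\<bar> \<le> real_of_int (int l + 1)" by (simp only: of_int_le_iff)
        then have "\<bar>real_of_int B\<bar> \<le> real l + 1" by simp
        then show "\<bar>L - of_int B\<bar> \<le> 2 * real l + 2" using \<theta> unfolding \<theta>_def by linarith
      qed simp
      finally have "real k * (2 * (real l)\<^sup>2) < real k * (2 * real l + 2)" using nr by (simp add: mult_ac)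
      then have "2 * (real l)\<^sup>2 < 2 * real l + 2" using l1 by simp
      then show False using ll lge by linarith
    qed
    then have "L = of_int B" using L l1 by simp
    then have "\<bar>real_of_int (B - int l)\<bar> < 1" using \<theta> by (simp add: \<theta>_def)
    then have "B = int l" by linarith
    then show ?thesis using c0 B2l by simp
  qed
qed

lemma int_abs_le_square: "\<bar>z\<bar> \<le> z\<^sup>2" for z :: int
  using self_le_power[of "\<bar>z\<bar>" 2] by (cases "z = 0") auto

context slice
begin

text \<open>Let \<open>j\<close> minimise \<open>g\<close>: then \<open>n * g j\<close> is at most
  the sum of \<open>g\<close>, which equals \<open>2 * n * g j - 2 * B\<^sup>2\<close> with
  \<open>B\<close> the sum of all \<open>s i - s j\<close>. The normalisation is free, since on the
  slice a common shift of the coefficients only changes the constant.\<close>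

lemma exists_central_coefficient:
  fixes s :: "'a \<Rightarrow> int"
  obtains j where "j \<in> X" "2 * (\<Sum>i\<in>X. s i - s j)\<^sup>2 \<le> int (card X) * (\<Sum>i\<in>X. (s i - s j)\<^sup>2)"
proof -
  define g where "g j = (\<Sum>i\<in>X. (s i - s j)\<^sup>2)" for j
  have "X \<noteq> {}" using kn by auto
  then obtain j where j: "j \<in> X" and min: "\<And>i. i \<in> X \<Longrightarrow> g j \<le> g i"
    using finX by (metis arg_min_if_finite(1) arg_min_least)
  define b where "b i = s i - s j" for i
  have "int (card X) * g j \<le> (\<Sum>i\<in>X. g i)"
    using sum_bounded_below[of X "g j" g] min by simp
  also have "\<dots> = (\<Sum>i\<in>X. \<Sum>t\<in>X. (b t)\<^sup>2 - 2 * b i * b t + (b i)\<^sup>2)"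
    unfolding g_def by (intro sum.cong refl) (simp add: b_def power2_eq_square algebra_simps)
  also have "\<dots> = 2 * (int (card X) * g j) - 2 * (\<Sum>i\<in>X. b i)\<^sup>2"
    by (simp add: sum.distrib sum_subtractf sum_distrib_left[symmetric] sum_distrib_right[symmetric]
        g_def b_def power2_eq_square)
  finally show thesis using that[OF j] by (simp add: g_def b_def)
qed

text \<open>Mean and second moment of the integral function \<open>w\<close> are explicit in its
  coefficients. Closeness to \<open>f\<close> pins down the mean and makes
  \<open>w * (w - 1)\<close> small on average, and these are the inputs of
  \<open>coefficient_dichotomy\<close>.\<close>

lemma integer_linear_near_boolean:
  fixes c :: int and s :: "'a \<Rightarrow> int"
  assumes l: "l > 0" and n: "card X > 2 * k * l\<^sup>2"
    and f: "\<And>x. x \<in> Sl \<Longrightarrow> f x \<in> {0, 1 :: real}"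
    and sumf: "(\<Sum>x\<in>Sl. f x) = (real l - \<alpha>) * M"
    and dist: "(\<Sum>x\<in>Sl. (f x - (of_int c + lin (\<lambda>i. of_int (s i)) x))\<^sup>2) \<le> \<tau> * M"
    and small: "\<tau> \<le> 1 / 200" "\<bar>\<alpha>\<bar> \<le> 1 / 200"
  shows "(\<exists>S\<subseteq>X. card S = l \<and> (\<forall>x\<in>Sl. of_int c + lin (\<lambda>i. of_int (s i)) x = real (card (x \<inter> S)))) \<or>
    (l = 1 \<and> (\<exists>j\<in>X. \<forall>x\<in>Sl. of_int c + lin (\<lambda>i. of_int (s i)) x = (if j \<in> x then 0 else 1)))"
proof -
  obtain j where j: "j \<in> X" "2 * (\<Sum>i\<in>X. s i - s j)\<^sup>2 \<le> int (card X) * (\<Sum>i\<in>X. (s i - s j)\<^sup>2)"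
    by (rule exists_central_coefficient)
  define b where "b i = s i - s j" for i
  define c0 where "c0 = c + int k * s j"
  define B where "B = (\<Sum>i\<in>X. b i)"
  define B2 where "B2 = (\<Sum>i\<in>X. (b i)\<^sup>2)"
  define br where "br i = real_of_int (b i)" for i
  define w where "w x = of_int c + lin (\<lambda>i. of_int (s i)) x" for x
  have w: "w x = of_int c0 + lin br x" if "x \<in> Sl" for x
    using that by (simp add: w_def c0_def lin_def br_def b_def sum_subtractf nsets_def)
  have wint: "w x = of_int (c + (\<Sum>i\<in>x. s i))" for x by (simp add: w_def lin_def)
  have pos: "N > 0" "N - 1 > 0" "N - K > 0" "K > 0" using N_gt K_ge_1 by auto
  have sbr: "(\<Sum>i\<in>X. br i) = of_int B" "(\<Sum>i\<in>X. (br i)\<^sup>2) = of_int B2"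
    by (simp_all add: br_def B_def B2_def)
  define L where "L = of_int c0 * N / K + of_int B"
  have cS: "real (card Sl) = N * M / K" using card_Sl pos by (simp add: field_simps)
  have sumw: "(\<Sum>x\<in>Sl. w x) = M * L"
  proof -
    have "(\<Sum>x\<in>Sl. w x) = (\<Sum>x\<in>Sl. of_int c0 + lin br x)" by (intro sum.cong refl w)
    also have "\<dots> = real (card Sl) * of_int c0 + M * of_int B" by (simp add: sum.distrib sum_lin sbr)
    finally show ?thesis unfolding cS L_def by (simp add: algebra_simps)
  qed
  have fw: "\<exists>z::int. f x - w x = of_int z" if "x \<in> Sl" for x
  proof -
    have "f x = of_int (if f x = 0 then 0 else 1)" using f[OF that] by auto
    then show ?thesis unfolding wint by (metis of_int_diff)
  qed
  have near: "\<bar>L - (real l - \<alpha>)\<bar> \<le> \<tau>"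
  proof -
    have "M * \<bar>L - (real l - \<alpha>)\<bar> = \<bar>M * (L - (real l - \<alpha>))\<bar>" using M_pos by (simp add: abs_mult)
    also have "M * (L - (real l - \<alpha>)) = (\<Sum>x\<in>Sl. w x - f x)"
      by (simp add: sum_subtractf sumw sumf algebra_simps)
    also have "\<bar>\<dots>\<bar> \<le> (\<Sum>x\<in>Sl. \<bar>w x - f x\<bar>)" by (rule sum_abs)
    \<comment> \<open>An integer has modulus at most its square, so the l2 bound also controls the
      l1 distance.\<close>
    also have "\<dots> \<le> (\<Sum>x\<in>Sl. (f x - w x)\<^sup>2)"
    proof (rule sum_mono)
      fix x assume "x \<in> Sl"
      then obtain z :: int where z: "f x - w x = of_int z" using fw by blast
      have "real_of_int \<bar>z\<bar> \<le> real_of_int (z\<^sup>2)" unfolding of_int_le_iff by (rule int_abs_le_square)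
      then show "\<bar>w x - f x\<bar> \<le> (f x - w x)\<^sup>2" unfolding abs_minus_commute[of "w x"] z by simp
    qed
    also have "\<dots> \<le> M * \<tau>" using dist by (simp add: w_def mult.commute)
    finally show ?thesis using M_pos by simp
  qed
  have var: "(N - K) / (N - 1) * (of_int B2 - (of_int B)\<^sup>2 / N) + K / N * L\<^sup>2 - L \<le> 2 * \<tau>"
  proof -
    define m where "m = K * L / N"
    define V where "V = of_int B2 - (of_int B)\<^sup>2 / N"
    have mm: "w x - m = lin br x - K * ((\<Sum>i\<in>X. br i) / N)" if "x \<in> Sl" for x
      using pos by (simp add: w[OF that] m_def L_def sbr field_simps)
    have "(\<Sum>x\<in>Sl. (w x - m)\<^sup>2) = M * (N - K) / (N - 1) * V"
      unfolding V_def sbr[symmetric] lin_variance[symmetric] by (intro sum.cong refl) (simp only: mm)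
    moreover have "(\<Sum>x\<in>Sl. (w x)\<^sup>2) = (\<Sum>x\<in>Sl. (w x - m)\<^sup>2 + 2 * m * w x - m\<^sup>2)"
      by (intro sum.cong refl) (simp add: power2_eq_square algebra_simps)
    moreover have "\<dots> = (\<Sum>x\<in>Sl. (w x - m)\<^sup>2) + 2 * m * (M * L) - N * M / K * m\<^sup>2"
      unfolding sum_subtractf sum.distrib sum_distrib_left[symmetric] sumw sum_constant cS ..
    moreover have "2 * m * (M * L) - N * M / K * m\<^sup>2 = M * (K / N * L\<^sup>2)"
      using pos by (simp add: m_def power2_eq_square field_simps)
    ultimately have w2: "(\<Sum>x\<in>Sl. (w x)\<^sup>2) = M * ((N - K) / (N - 1) * V + K / N * L\<^sup>2)"
      by (simp add: algebra_simps)
    have "M * ((N - K) / (N - 1) * V + K / N * L\<^sup>2 - L) = (\<Sum>x\<in>Sl. (w x)\<^sup>2 - w x)"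
      by (simp add: sum_subtractf w2 sumw algebra_simps)
    also have "\<dots> \<le> (\<Sum>x\<in>Sl. 2 * (f x - w x)\<^sup>2)"
    proof (rule sum_mono)
      fix x assume x: "x \<in> Sl"
      define z where "z = c + (\<Sum>i\<in>x. s i)"
      have z: "w x = of_int z" by (simp add: wint z_def)
      \<comment> \<open>For integers, \<open>z\<^sup>2 - z\<close> is at most twice the squared
        distance to 0 and to 1, hence to whichever value \<open>f x\<close> takes.\<close>
      have "z\<^sup>2 - z \<le> 2 * (0 - z)\<^sup>2" "z\<^sup>2 - z \<le> 2 * (1 - z)\<^sup>2"
      proof -
        show "z\<^sup>2 - z \<le> 2 * (0 - z)\<^sup>2" using int_abs_le_square[of z] by simp
        have "(z - 1) * (z - 2) \<ge> 0"
        proof (cases "z \<le> 1")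
          case True then show ?thesis by (intro mult_nonpos_nonpos) auto
        qed auto
        then show "z\<^sup>2 - z \<le> 2 * (1 - z)\<^sup>2" by (simp add: power2_eq_square algebra_simps)
      qed
      then have "real_of_int (z\<^sup>2 - z) \<le> real_of_int (2 * (0 - z)\<^sup>2)" "real_of_int (z\<^sup>2 - z) \<le> real_of_int (2 * (1 - z)\<^sup>2)"
        by (simp_all only: of_int_le_iff)
      then show "(w x)\<^sup>2 - w x \<le> 2 * (f x - w x)\<^sup>2" using f[OF x] by (auto simp: z)
    qed
    also have "\<dots> \<le> M * (2 * \<tau>)" using dist by (simp add: sum_distrib_left[symmetric] w_def mult_ac)
    finally show ?thesis using M_pos by (simp add: V_def)
  qed
  have absB: "\<bar>B\<bar> \<le> B2"
  proof -
    have "\<bar>B\<bar> \<le> (\<Sum>i\<in>X. \<bar>b i\<bar>)" unfolding B_def by (rule sum_abs)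
    also have "\<dots> \<le> B2" unfolding B2_def by (intro sum_mono int_abs_le_square)
    finally show ?thesis .
  qed
  have "L * K = of_int c0 * N + of_int B * K" using pos by (simp add: L_def field_simps)
  then have dich: "(c0 = 0 \<and> B = int l \<and> B2 \<le> int l + 1) \<or> (l = 1 \<and> c0 = 1 \<and> B = - 1 \<and> B2 = 1)"
    using j(2) absB near small var
    by (intro coefficient_dichotomy[OF kpos l n]) (auto simp: B_def B2_def b_def K_def N_def)
  \<comment> \<open>With \<open>y = e * b t\<close> each summand of \<open>B2 - e * B\<close> is
    \<open>y * (y - 1)\<close>, which is at least 2 unless \<open>y\<close> is 0 or 1; a total below
    2 therefore determines every coefficient up to that choice. In particular
    \<open>B2 = l + 1\<close> cannot occur together with \<open>B = l\<close>.\<close>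
  have parity: "b i \<in> {0, e}" if "i \<in> X" "e = 1 \<or> e = - 1" "B2 - e * B < 2" for i e
  proof (rule ccontr)
    assume no: "b i \<notin> {0, e}"
    have nn: "(b t)\<^sup>2 - e * b t \<ge> 0" for t
      using that(2) int_abs_le_square[of "b t"] by (auto simp: abs_le_iff)
    have "(b i)\<^sup>2 - e * b i \<le> (\<Sum>t\<in>X. (b t)\<^sup>2 - e * b t)"
      using that(1) finX nn by (intro member_le_sum) auto
    also have "\<dots> = B2 - e * B" by (simp add: sum_subtractf B2_def B_def sum_distrib_left)
    finally have "(b i)\<^sup>2 - e * b i < 2" using that(3) by simp
    moreover have "(b i)\<^sup>2 - e * b i \<ge> 2"
    proof -
      define y where "y = e * b i"
      have y: "(b i)\<^sup>2 = y\<^sup>2" "y \<noteq> 0" "y \<noteq> 1" using no that(2) by (auto simp: y_def)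
      have "(y - 2) * (y + 1) \<ge> 0"
      proof (cases "y \<ge> 2")
        case False
        then show ?thesis using y by (intro mult_nonpos_nonpos) auto
      qed auto
      then show ?thesis using y by (simp add: y_def[symmetric] power2_eq_square algebra_simps)
    qed
    ultimately show False by simp
  qed
  from dich show ?thesis
  proof
    assume A: "c0 = 0 \<and> B = int l \<and> B2 \<le> int l + 1"
    define S where "S = {i \<in> X. b i = 1}"
    have b01: "b i = (if i \<in> S then 1 else 0)" if "i \<in> X" for i
      using parity[OF that, of 1] A that by (auto simp: S_def)
    have "int l = (\<Sum>i\<in>X. if i \<in> S then 1 else 0)" using A b01 by (simp add: B_def)
    also have "\<dots> = int (card S)" using finX by (simp add: sum.If_cases S_def Collect_conj_eq)
    finally have "card S = l" by simp
    moreover have "w x = real (card (x \<inter> S))" if x: "x \<in> Sl" for x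
    proof -
      have "w x = (\<Sum>i\<in>x. if i \<in> S then 1 else 0)"
        unfolding w[OF x] lin_def using A x b01 by (auto simp: br_def nsets_def intro!: sum.cong)
      also have "\<dots> = real (card (x \<inter> S))" using x by (simp add: sum.If_cases nsets_def)
      finally show ?thesis .
    qed
    moreover have "S \<subseteq> X" by (auto simp: S_def)
    ultimately show ?thesis unfolding w_def by (intro disjI1 exI[of _ S] conjI ballI) auto
  next
    assume A: "l = 1 \<and> c0 = 1 \<and> B = - 1 \<and> B2 = 1"
    define S where "S = {i \<in> X. b i = - 1}"
    have b01: "b i = (if i \<in> S then - 1 else 0)" if "i \<in> X" for i
      using parity[OF that, of "- 1"] A that by (auto simp: S_def)
    have "- 1 = (\<Sum>i\<in>X. if i \<in> S then - 1 else 0 :: int)" using A b01 by (simp add: B_def)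
    also have "\<dots> = - int (card S)" using finX by (simp add: sum.If_cases S_def Collect_conj_eq)
    finally have "card S = 1" by simp
    then obtain t where t: "S = {t}" by (rule card_1_singletonE)
    have "w x = (if t \<in> x then 0 else 1)" if x: "x \<in> Sl" for x
    proof -
      have "lin br x = (\<Sum>i\<in>x. if i = t then - 1 else 0)"
        unfolding lin_def using x b01 t by (intro sum.cong refl) (auto simp: br_def nsets_def)
      then have "w x = 1 + (\<Sum>i\<in>x. if i = t then - 1 else 0)" unfolding w[OF x] using A by simp
      also have "\<dots> = (if t \<in> x then 0 else 1)" using x by (simp add: nsets_def)
      finally show ?thesis .
    qed
    moreover have "t \<in> X" using t by (auto simp: S_def)
    ultimately show ?thesis using A unfolding w_def by (intro disjI2 conjI bexI[of _ t] ballI) auto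
  qed
qed

text \<open>Inside the complement of a star every set has \<open>D = C(n-k-1, k)\<close> neighbours,
  and each of its sets missing from \<open>\<F>\<close> destroys at most \<open>2 * D\<close>
  ordered pairs. This complement has at least \<open>M\<close> members because
  \<open>n > 2 * k\<close>.\<close>

lemma near_antistar_many_disjoint_pairs:
  assumes F: "\<F> \<subseteq> Sl" and i: "i \<in> X"
    and dist: "(\<Sum>x\<in>Sl. (indicator \<F> x - (if i \<in> x then 0 else 1))\<^sup>2) \<le> \<tau> * M"
  shows "mu * (N - 2 * K) / K * (M * (1 - 2 * \<tau>)) \<le> 2 * real (dp \<F>)"
proof -
  define f where "f = (indicator \<F> :: 'a set \<Rightarrow> real)"
  define t where "t x = (if i \<in> x then 0 else 1 :: real)" for x
  define D where "D = mu * (N - 2 * K) / K"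
  have pos: "K > 0" "N - 2 * K > 0" using N_gt K_ge_1 by auto
  have kt: "kneser X k t x = D" if x: "x \<in> Sl" "i \<notin> x" for x
  proof -
    have fin': "finite (X - x - {i})" using finX by simp
    have set: "{y. y \<in> Sl \<and> y \<inter> x = {} \<and> i \<notin> y} = nsets (X - x - {i}) k" by (auto simp: nsets_def)
    have "kneser X k t x = (\<Sum>y | y \<in> Sl \<and> y \<inter> x = {} \<and> i \<notin> y. 1)"
      unfolding kneser_def by (intro sum.mono_neutral_cong_right) (use finite_Sl in \<open>auto simp: t_def\<close>)
    also have "\<dots> = real (card (X - x - {i}) choose k)" unfolding set using fin' by (simp add: card_nsets_finite)
    also have "card (X - x - {i}) = card X - k - 1"
      using x i finX by (simp add: nsets_def card_Diff_subset)
    finally have 1: "kneser X k t x = real ((card X - k - 1) choose k)" .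
    define m where "m = card X - k - 1"
    have "k * (m choose k) = m * ((m - 1) choose (k - 1))"
      using binomial_absorption[of "k - 1" m] kpos by simp
    also have "\<dots> = (m - (k - 1)) * (m choose (k - 1))" by (rule binomial_absorb_comp[symmetric])
    finally have "real k * real (m choose k) = real (m - (k - 1)) * real (m choose (k - 1))"
      by (metis of_nat_mult)
    moreover have "real (m - (k - 1)) = N - 2 * K" using kn kpos by (simp add: m_def N_def K_def of_nat_diff)
    ultimately have "K * kneser X k t x = (N - 2 * K) * mu" unfolding 1 mu_def m_def K_def by simp
    then show ?thesis using pos by (simp add: D_def field_simps)
  qed
  have tk: "t x * kneser X k t x = t x * D" if "x \<in> Sl" for x
    using kt[OF that] by (simp add: t_def)
  define T where "T = (\<Sum>x\<in>Sl. t x)"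
  have "T = real (card Sl) - real (card {x \<in> Sl. i \<in> x})"
  proof -
    have "T + (\<Sum>x\<in>Sl. if i \<in> x then 1 else 0) = (\<Sum>x\<in>Sl. 1)"
      unfolding T_def sum.distrib[symmetric] by (intro sum.cong) (auto simp: t_def)
    then show ?thesis using finite_Sl by (simp add: sum.If_cases Collect_conj_eq)
  qed
  also have "\<dots> = N * M / K - M" using card_Sl card_star[OF i] pos by (simp add: field_simps)
  also have "\<dots> \<ge> M"
  proof -
    have "2 * M \<le> N / K * M" using pos M_pos by (intro mult_right_mono) (auto simp: field_simps)
    then show ?thesis by simp
  qed
  finally have TM: "T \<ge> M" .
  have miss: "(\<Sum>x\<in>Sl. t x * (1 - f x)) \<le> \<tau> * M"
  proof -
    have "(\<Sum>x\<in>Sl. t x * (1 - f x)) \<le> (\<Sum>x\<in>Sl. (f x - t x)\<^sup>2)"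
      by (intro sum_mono) (auto simp: f_def t_def indicator_def)
    then show ?thesis using dist by (simp add: f_def t_def)
  qed
  have D0: "D \<ge> 0" using pos mu_pos by (simp add: D_def)
  have "D * (M * (1 - 2 * \<tau>)) \<le> D * (T - 2 * (\<Sum>x\<in>Sl. t x * (1 - f x)))"
    using miss TM D0 by (intro mult_left_mono) (auto simp: algebra_simps)
  also have "\<dots> = (\<Sum>x\<in>Sl. f x * (t x * D)) + (\<Sum>x\<in>Sl. f x * (t x * D)) - (\<Sum>x\<in>Sl. t x * D)"
    unfolding T_def sum_distrib_left sum.distrib[symmetric] sum_subtractf[symmetric]
    by (intro sum.cong refl) (simp add: algebra_simps)
  also have "(\<Sum>x\<in>Sl. f x * (t x * D)) = (\<Sum>x\<in>Sl. (f x * t x) * kneser X k t x)"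
    by (intro sum.cong refl) (simp add: tk[symmetric])
  also have "(\<Sum>x\<in>Sl. t x * D) = (\<Sum>x\<in>Sl. t x * kneser X k t x)"
    by (intro sum.cong refl) (simp add: tk)
  also have "(\<Sum>x\<in>Sl. (f x * t x) * kneser X k t x) + (\<Sum>x\<in>Sl. (f x * t x) * kneser X k t x)
      - (\<Sum>x\<in>Sl. t x * kneser X k t x) =
     (\<Sum>x\<in>Sl. (f x * t x) * kneser X k t x) + (\<Sum>x\<in>Sl. t x * kneser X k (\<lambda>y. f y * t y) x)
      - (\<Sum>x\<in>Sl. t x * kneser X k t x)"
    using kneser_selfadjoint[of "\<lambda>x. f x * t x" t] by simp
  also have "\<dots> \<le> (\<Sum>x\<in>Sl. f x * kneser X k f x)"
    unfolding sum.distrib[symmetric] sum_subtractf[symmetric]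
  proof (rule sum_mono)
    fix x
    \<comment> \<open>If \<open>t x = t y = 1\<close> this says
      \<open>(1 - f x) * (1 - f y) \<ge> 0\<close>; otherwise the left side is zero.\<close>
    have pw: "f x * t x * t y + t x * (f y * t y) - t x * t y \<le> f x * f y" for y
      by (auto simp: f_def t_def indicator_def)
    have "f x * t x * kneser X k t x + t x * kneser X k (\<lambda>y. f y * t y) x - t x * kneser X k t x =
      (\<Sum>y | y \<in> Sl \<and> y \<inter> x = {}. f x * t x * t y + t x * (f y * t y) - t x * t y)"
      by (simp add: kneser_def sum_distrib_left sum.distrib sum_subtractf)
    also have "\<dots> \<le> (\<Sum>y | y \<in> Sl \<and> y \<inter> x = {}. f x * f y)" by (rule sum_mono) (rule pw)
    also have "\<dots> = f x * kneser X k f x" by (simp add: kneser_def sum_distrib_left)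
    finally show "f x * t x * kneser X k t x + t x * kneser X k (\<lambda>y. f y * t y) x - t x * kneser X k t x
      \<le> f x * kneser X k f x" .
  qed
  also have "\<dots> = 2 * real (dp \<F>)"
    unfolding f_def by (rule sum_indicator_disjoint_pairs[OF finX kpos F])
  finally show ?thesis by (simp add: D_def)
qed

end

section \<open>Assembling the estimates\<close>

lemma real_choose_2: "real (l choose 2) = real l * (real l - 1) / 2"
  by (induction l) (simp_all add: numeral_2_eq_2 field_simps)

context slice
begin

text \<open>On the symmetric difference one of the two numbers compared is 0 and the other a
  positive integer, so each such set contributes at least 1.\<close>

lemma card_sym_diff_stars_le:
  assumes F: "\<F> \<subseteq> Sl" and S: "S \<subseteq> X"
  shows "real (card (sym_diff \<F> {x \<in> Sl. x \<inter> S \<noteq> {}})) \<le>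
    (\<Sum>x\<in>Sl. (indicator \<F> x - real (card (x \<inter> S)))\<^sup>2)"
proof -
  define D where "D = sym_diff \<F> {x \<in> Sl. x \<inter> S \<noteq> {}}"
  have sub: "D \<subseteq> Sl" using F by (auto simp: D_def)
  have "real (card D) = (\<Sum>x\<in>D. 1)" by simp
  also have "\<dots> \<le> (\<Sum>x\<in>D. (indicator \<F> x - real (card (x \<inter> S)))\<^sup>2)"
  proof (rule sum_mono)
    fix x assume x: "x \<in> D"
    then have fin: "finite (x \<inter> S)" using sub by (auto simp: nsets_def)
    show "1 \<le> (indicator \<F> x - real (card (x \<inter> S)))\<^sup>2"
    proof (cases "x \<in> \<F>")
      case True
      then have "x \<inter> S = {}" using x sub by (auto simp: D_def)
      then show ?thesis using True by simp
    next
      case False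
      then have "x \<inter> S \<noteq> {}" using x by (auto simp: D_def)
      then have "card (x \<inter> S) \<ge> 1" using fin by (simp add: Suc_le_eq card_gt_0_iff)
      then show ?thesis using False by simp
    qed
  qed
  also have "\<dots> \<le> (\<Sum>x\<in>Sl. (indicator \<F> x - real (card (x \<inter> S)))\<^sup>2)"
    by (rule sum_mono2[OF finite_Sl sub]) simp
  finally show ?thesis unfolding D_def .
qed

text \<open>The expression of the theorem arises here: \<open>2 * (l choose 2) + 2 * \<beta> - (l -
  \<alpha>)\<^sup>2 + (l - \<alpha>)\<close> equals
  \<open>(2 * l - 1) * \<alpha> + 2 * \<beta> - \<alpha>\<^sup>2\<close>. The gap is weakened to
  \<open>(N - 2 * K) / N\<close>.\<close>

lemma near_linear_distance:
  assumes F: "\<F> \<subseteq> Sl" and card: "real (card \<F>) = (real l - \<alpha>) * M"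
    and dp: "real (dp \<F>) \<le> (real (l choose 2) + \<beta>) * M * mu"
  obtains a where "(\<Sum>x\<in>Sl. (indicator \<F> x - lin a x)\<^sup>2)
    \<le> ((2 * real l - 1) * \<alpha> + 2 * \<beta>) * (N / (N - 2 * K)) * M"
proof -
  obtain a where a: "mu * (N - 2 * K) / (N - K - 1) * (\<Sum>x\<in>Sl. (indicator \<F> x - lin a x)\<^sup>2)
    \<le> 2 * real (dp \<F>) - mu * ((real (card \<F>))\<^sup>2 / M - real (card \<F>))"
    by (rule few_disjoint_pairs_near_linear[OF F])
  define Q where "Q = (\<Sum>x\<in>Sl. (indicator \<F> x - lin a x)\<^sup>2)"
  define D where "D = (2 * real l - 1) * \<alpha> + 2 * \<beta>"
  have pos: "N - 2 * K > 0" "N - K - 1 > 0" "N > 0" "N - K - 1 \<le> N" using N_gt K_ge_1 by auto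
  have Q0: "Q \<ge> 0" by (simp add: Q_def sum_nonneg)
  have "mu * (N - 2 * K) / (N - K - 1) * Q \<le> 2 * ((real (l choose 2) + \<beta>) * M * mu) -
      mu * (((real l - \<alpha>) * M)\<^sup>2 / M - (real l - \<alpha>) * M)"
    using a dp unfolding card Q_def by linarith
  also have "\<dots> = mu * M * (D - \<alpha>\<^sup>2)"
    using M_pos by (simp add: D_def real_choose_2 power2_eq_square field_simps)
  also have "\<dots> \<le> mu * M * D" using M_pos mu_pos by (intro mult_left_mono) auto
  finally have "mu * ((N - 2 * K) / (N - K - 1) * Q) \<le> mu * (M * D)" by (simp add: mult_ac)
  then have le: "(N - 2 * K) / (N - K - 1) * Q \<le> M * D" by (rule mult_left_le_imp_le) (rule mu_pos)
  have "(N - 2 * K) / N * Q \<le> (N - 2 * K) / (N - K - 1) * Q"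
    using pos Q0 by (intro mult_right_mono divide_left_mono) auto
  with le have "(N - 2 * K) / N * Q \<le> M * D" by linarith
  then have "Q \<le> D * (N / (N - 2 * K)) * M" using pos by (simp add: field_simps)
  then show thesis using that[of a] by (simp add: Q_def D_def)
qed

text \<open>400000000 is \<open>(20 * C)\<^sup>2\<close> for \<open>C = 1000\<close>.\<close>

lemma union_of_stars_near:
  assumes l: "l > 0" and n: "card X > 2 * k * l\<^sup>2"
    and small: "2 * real l * \<bar>\<alpha>\<bar> \<le> (N - 2 * K) / (400000000 * N)" "\<bar>\<beta>\<bar> \<le> (N - 2 * K) / (400000000 * N)"
    and F: "\<F> \<subseteq> Sl" and card: "real (card \<F>) = (real l - \<alpha>) * M"
    and dp: "real (dp \<F>) \<le> (real (l choose 2) + \<beta>) * M * mu"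
  obtains S where "S \<subseteq> X" "card S = l"
    "real (card (sym_diff \<F> {x \<in> Sl. x \<inter> S \<noteq> {}})) \<le>
      1000 * ((2 * real l - 1) * \<alpha> + 2 * \<beta>) * (N / (N - 2 * K)) * M"
proof -
  define f where "f = (indicator \<F> :: 'a set \<Rightarrow> real)"
  define \<delta> where "\<delta> = ((2 * real l - 1) * \<alpha> + 2 * \<beta>) * (N / (N - 2 * K))"
  define \<tau> where "\<tau> = 648 * \<delta>"
  have pos: "N - 2 * K > 0" "N > 0" "K > 0" using N_gt K_ge_1 by auto
  have f: "f x \<in> {0, 1}" for x by (simp add: f_def indicator_def)
  have sumf: "(\<Sum>x\<in>Sl. f x) = (real l - \<alpha>) * M"
    unfolding card[symmetric] f_def using F finite_Sl by (simp add: sum_indicator_real Int_absorb1)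
  obtain a where dist: "(\<Sum>x\<in>Sl. (f x - lin a x)\<^sup>2) \<le> \<delta> * M"
    using near_linear_distance[OF F card dp] unfolding f_def \<delta>_def by blast
  \<comment> \<open>The hypotheses allow negative \<open>\<alpha>\<close> and
    \<open>\<beta>\<close>; that \<open>\<delta>\<close> is nonnegative follows because it bounds a
    sum of squares.\<close>
  have "0 \<le> \<delta> * M" by (rule order_trans[OF sum_nonneg dist]) simp
  then have \<delta>0: "\<delta> \<ge> 0" using M_pos by (simp add: zero_le_mult_iff)
  have l1: "real l \<ge> 1" using l by simp
  have \<delta>: "\<delta> \<le> 3 / 400000000"
  proof -
    have "(2 * real l - 1) * \<alpha> \<le> (2 * real l - 1) * \<bar>\<alpha>\<bar>" using l1 by (intro mult_left_mono) auto
    also have "\<dots> \<le> 2 * real l * \<bar>\<alpha>\<bar>" by (intro mult_right_mono) auto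
    finally have "(2 * real l - 1) * \<alpha> + 2 * \<beta> \<le> 3 * ((N - 2 * K) / (400000000 * N))"
      using small by linarith
    then have "\<delta> \<le> 3 * ((N - 2 * K) / (400000000 * N)) * (N / (N - 2 * K))"
      unfolding \<delta>_def using pos by (intro mult_right_mono) auto
    also have "\<dots> = 3 / 400000000" using pos by (simp add: field_simps)
    finally show ?thesis .
  qed
  have ratio: "(N - 2 * K) / (400000000 * N) \<le> 1 / 400000000" using pos by (simp add: field_simps)
  have \<alpha>: "\<bar>\<alpha>\<bar> \<le> 1 / 200"
  proof -
    have "1 * \<bar>\<alpha>\<bar> \<le> 2 * real l * \<bar>\<alpha>\<bar>" using l1 by (intro mult_right_mono) auto
    then show ?thesis using small(1) ratio by linarith
  qed
  have \<tau>: "\<tau> \<le> 1 / 200" using \<delta> by (simp add: \<tau>_def)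
  obtain c :: int and s :: "'a \<Rightarrow> int" where
    approx: "(\<Sum>x\<in>Sl. (f x - (of_int c + lin (\<lambda>i. of_int (s i)) x))\<^sup>2) \<le> 648 * \<delta> * M"
    using integer_approximation[OF f dist] by blast
  define w where "w x = of_int c + lin (\<lambda>i. of_int (s i)) x" for x
  have fw: "(\<Sum>x\<in>Sl. (f x - w x)\<^sup>2) \<le> \<tau> * M" using approx by (simp add: w_def \<tau>_def)
  have "(\<exists>S\<subseteq>X. card S = l \<and> (\<forall>x\<in>Sl. w x = real (card (x \<inter> S)))) \<or>
    (l = 1 \<and> (\<exists>j\<in>X. \<forall>x\<in>Sl. w x = (if j \<in> x then 0 else 1)))"
    unfolding w_def
    by (rule integer_linear_near_boolean[OF l n f sumf fw[unfolded w_def] \<tau> \<alpha>])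
  then show thesis
  proof
    assume "\<exists>S\<subseteq>X. card S = l \<and> (\<forall>x\<in>Sl. w x = real (card (x \<inter> S)))"
    then obtain S where S: "S \<subseteq> X" "card S = l" "\<And>x. x \<in> Sl \<Longrightarrow> w x = real (card (x \<inter> S))" by blast
    have "real (card (sym_diff \<F> {x \<in> Sl. x \<inter> S \<noteq> {}})) \<le> (\<Sum>x\<in>Sl. (f x - real (card (x \<inter> S)))\<^sup>2)"
      unfolding f_def by (rule card_sym_diff_stars_le[OF F S(1)])
    also have "\<dots> = (\<Sum>x\<in>Sl. (f x - w x)\<^sup>2)" by (intro sum.cong refl) (simp add: S(3))
    also have "\<dots> \<le> \<tau> * M" by (rule fw)
    also have "\<dots> \<le> 1000 * \<delta> * M" using \<delta>0 M_pos by (intro mult_right_mono) (auto simp: \<tau>_def)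
    finally show thesis by (intro that[OF S(1,2)]) (simp only: \<delta>_def mult.assoc)
  next
    assume "l = 1 \<and> (\<exists>j\<in>X. \<forall>x\<in>Sl. w x = (if j \<in> x then 0 else 1))"
    then obtain j where l1: "l = 1" and j: "j \<in> X" "\<And>x. x \<in> Sl \<Longrightarrow> w x = (if j \<in> x then 0 else 1)" by blast
    have "(\<Sum>x\<in>Sl. (f x - (if j \<in> x then 0 else 1))\<^sup>2) = (\<Sum>x\<in>Sl. (f x - w x)\<^sup>2)"
      by (intro sum.cong refl) (simp add: j(2))
    then have "(\<Sum>x\<in>Sl. (indicator \<F> x - (if j \<in> x then 0 else 1))\<^sup>2) \<le> \<tau> * M"
      using fw by (simp add: f_def)
    \<comment> \<open>For \<open>l = 1\<close> the binomial coefficient vanishes, so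
      \<open>\<F>\<close> has at most \<open>\<beta> * M * mu\<close> disjoint pairs, while
      closeness to the complement of a star forces about \<open>(N - 2 * K) / (2 * K)\<close> times
      \<open>M * mu\<close>. Since \<open>\<beta>\<close> is small relative to
      \<open>(N - 2 * K) / N\<close>, this is impossible however close \<open>n\<close> is to
      \<open>2 * k\<close>.\<close>
    from near_antistar_many_disjoint_pairs[OF F j(1) this]
    have "mu * (N - 2 * K) / K * (M * (1 - 2 * \<tau>)) \<le> 2 * (\<beta> * M * mu)"
      using dp l1 by (simp add: numeral_2_eq_2)
    then have "(M * mu) * ((N - 2 * K) / K * (1 - 2 * \<tau>)) \<le> (M * mu) * (2 * \<beta>)" by (simp add: mult_ac)
    then have "(N - 2 * K) / K * (1 - 2 * \<tau>) \<le> 2 * \<beta>"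
      by (rule mult_left_le_imp_le) (use M_pos mu_pos in simp)
    moreover have "(N - 2 * K) / K * (1 / 2) \<le> (N - 2 * K) / K * (1 - 2 * \<tau>)"
      using pos \<tau> by (intro mult_left_mono) auto
    ultimately have "(N - 2 * K) / K * (1 / 2) \<le> 2 * \<beta>" by (rule order_trans[rotated])
    moreover have "(N - 2 * K) / N \<le> (N - 2 * K) / K"
      using pos N_gt by (intro divide_left_mono) auto
    moreover have "\<bar>\<beta>\<bar> \<le> (N - 2 * K) / N * (1 / 400000000)" using small(2) by simp
    moreover have "(N - 2 * K) / N > 0" using pos by simp
    moreover have False if "y * (1 / 2) \<le> 2 * \<beta>" "z \<le> y" "\<bar>\<beta>\<bar> \<le> z * (1 / 400000000)" "z > 0" for y z
      using that by linarith
    ultimately have False by blast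
    then show thesis ..
  qed
qed

end

theorem theorem1p2:
  shows "\<exists>C::real. C > 1 \<and>
    (\<forall>(n::nat) (k::nat) (l::nat) (\<alpha>::real) (\<beta>::real) (\<F>::nat set set).
      n > 0 \<longrightarrow> k > 0 \<longrightarrow> l > 0 \<longrightarrow> n > 2 * k * l\<^sup>2 \<longrightarrow>
      max (2 * real l * \<bar>\<alpha>\<bar>) \<bar>\<beta>\<bar> \<le> (real n - 2 * real k) / ((20 * C)\<^sup>2 * real n) \<longrightarrow>
      \<F> \<subseteq> nsets {1..n} k \<longrightarrow>
      real (card \<F>) = (real l - \<alpha>) * real ((n - 1) choose (k - 1)) \<longrightarrow>
      real (dp \<F>) \<le> (real (l choose 2) + \<beta>) * real ((n - 1) choose (k - 1))
                        * real ((n - k - 1) choose (k - 1)) \<longrightarrow>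
      (\<exists>\<S>. union_of_stars n k l \<S> \<and>
        real (card (sym_diff \<F> \<S>)) \<le>
          C * ((2 * real l - 1) * \<alpha> + 2 * \<beta>) * (real n / (real n - 2 * real k))
            * real ((n - 1) choose (k - 1))))"
proof (intro exI[of _ "1000::real"] conjI allI impI)
  fix n k l :: nat and \<alpha> \<beta> :: real and \<F> :: "nat set set"
  assume k: "k > 0" and l: "l > 0" and n: "n > 2 * k * l\<^sup>2"
    and small: "max (2 * real l * \<bar>\<alpha>\<bar>) \<bar>\<beta>\<bar> \<le> (real n - 2 * real k) / ((20 * 1000)\<^sup>2 * real n)"
    and F: "\<F> \<subseteq> nsets {1..n} k"
    and card: "real (card \<F>) = (real l - \<alpha>) * real ((n - 1) choose (k - 1))"
    and dp: "real (dp \<F>) \<le> (real (l choose 2) + \<beta>) * real ((n - 1) choose (k - 1))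
                        * real ((n - k - 1) choose (k - 1))"
  have "2 * k * 1 \<le> 2 * k * l\<^sup>2" using l by (intro mult_le_mono2) simp
  then have "2 * k < n" using n by linarith
  then interpret slice "{1..n}" k using k by unfold_locales auto
  have NKM: "N = real n" "K = real k" "M = real ((n - 1) choose (k - 1))" "mu = real ((n - k - 1) choose (k - 1))"
    unfolding N_def K_def M_def mu_def by simp_all
  have nX: "card {1..n} > 2 * k * l\<^sup>2" using n by simp
  have sm: "2 * real l * \<bar>\<alpha>\<bar> \<le> (N - 2 * K) / (400000000 * N)" "\<bar>\<beta>\<bar> \<le> (N - 2 * K) / (400000000 * N)"
    using small unfolding NKM by simp_all
  obtain S where S: "S \<subseteq> {1..n}" "card S = l"
    "real (card (sym_diff \<F> {x \<in> nsets {1..n} k. x \<inter> S \<noteq> {}})) \<le>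
      1000 * ((2 * real l - 1) * \<alpha> + 2 * \<beta>) * (N / (N - 2 * K)) * M"
    by (rule union_of_stars_near[OF l nX sm F card[folded NKM(3)] dp[folded NKM(3,4)]])
  have "{x \<in> nsets {1..n} k. x \<inter> S \<noteq> {}} = (\<Union>i\<in>S. star n k i)" by (auto simp: star_def)
  then have "union_of_stars n k l {x \<in> nsets {1..n} k. x \<inter> S \<noteq> {}}"
    unfolding union_of_stars_def using S by blast
  then show "\<exists>\<S>. union_of_stars n k l \<S> \<and>
        real (card (sym_diff \<F> \<S>)) \<le>
          1000 * ((2 * real l - 1) * \<alpha> + 2 * \<beta>) * (real n / (real n - 2 * real k))
            * real ((n - 1) choose (k - 1))"
    using S(3) unfolding NKM by blast
qed simp

end
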